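(* Let $\overline{\Gamma}$ be a graph obtained from construction data with parameters $(\lambda,\mu)=(2,2)$ as defined in the context, and suppose that each of the three graphs $\Gamma_1,\Gamma_2,\Gamma_3$ is isomorphic to the $4\times 4$ rook graph or to the Shrikhande graph. Then the adjacency matrix of $\overline{\Gamma}$ has spectrum $14^1\,6^1\,2^{26}\,(-2)^{12}\,(-6)^8$ (exponents denote multiplicities).
   Context: Graphs are finite, simple and undirected. For $k\ge 1$, a $k$-regular graph on $v\ge 2$ vertices is edge-regular with parameters $(v,k,\lambda)$ if any two adjacent vertices have exactly $\lambda$ common neighbours. The $4\times4$ rook graph is the Cartesian product $K_4\,\square\,K_4$; the Shrikhande graph is the unique (up to isomorphism) strongly regular graph with parameters $(16,6,2,2)$ not isomorphic to the $4\times 4$ rook graph. Construction data with parameters $(\lambda,\mu)$, where $\lambda,\mu$ are positive integers with $\mu\mid(\lambda+2)$. Put $n:=\mu\lambda(\lambda+2)$, $k:=\lambda(\mu+1)$, $\nu:=(\lambda+2)/\mu$. The data consist of the following. - Three vertex-disjoint edge-regular graphs $\Gamma_i=(V_i,E_i)$, $i\in\{1,2,3\}$, each with parameters $(n,k,\lambda)$. - For each $i$, a partition $\Omega_i$ of $V_i$ into $\nu$ sets of size $\mu^2\lambda$, and two partitions $\mathcal{P}_i,\mathcal{P}_i'$ of $V_i$ into $\mu\nu$ independent sets of $\Gamma_i$ of size $\mu\lambda$, such that every element of $\Omega_i$ is the union of $\mu$ elements of $\mathcal{P}_i$ and also the union of $\mu$ elements of $\mathcal{P}_i'$, and such that whenever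 $\omega\in\Omega_i$, $P\in\mathcal{P}_i$, $P'\in\mathcal{P}_i'$ satisfy $P,P'\subseteq\omega$, then $|P\cap P'|=\lambda$. - Three admissible bijections $\varphi_{12}:\mathcal{P}_1\to\mathcal{P}_2'$, $\varphi_{23}:\mathcal{P}_2\to\mathcal{P}_3'$, $\varphi_{31}:\mathcal{P}_3\to\mathcal{P}_1'$. Here a bijection $\varphi:\mathcal{P}_i\to\mathcal{P}_j'$ ($i\ne j$) is admissible if for every $\omega=P_1\cup\dots\cup P_\mu\in\Omega_i$ with $P_1,\dots,P_\mu\in\mathcal{P}_i$, the set $\omega^\varphi:=P_1^\varphi\cup\dots\cup P_\mu^\varphi$ belongs to $\Omega_j$; so $\varphi$ induces a map $\Omega_i\to\Omega_j$. It is required that the composition of the induced maps $\Omega_1\to\Omega_2\to\Omega_3\to\Omega_1$ (of $\varphi_{12}$, then $\varphi_{23}$, then $\varphi_{31}$) is the identity on $\Omega_1$. The graph $\overline{\Gamma}$ has vertex set $V_1\cup V_2\cup V_3$. Two vertices of the same $V_i$ are adjacent in $\overline{\Gamma}$ iff they are adjacent in $\Gamma_i$. For $(i,j)\in\{(1,2),(2,3),(3,1)\}$, a vertex $v\in V_i$ and a vertex $w\in V_j$ are adjacent iff $w\in\varphi_{ij}(P)$, where $P$ is the unique element of $\mathcal{P}_i$ containing $v$. *)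

theory Defs
  imports
    "HOL-Library.Disjoint_Sets"
    "Graph_Theory.Graph_Theory"
    "Jordan_Normal_Form.Char_Poly"
begin

section \<open>Edge-regular and strongly regular graphs\<close>

text \<open>
  A finite simple undirected graph is a \<^term>\<open>G :: 'a pair_pre_digraph\<close> satisfying
  \<^term>\<open>pair_graph G\<close> (finite, symmetric, loopless); each edge is represented by its two arcs.
\<close>

definition nbrs :: "'a pair_pre_digraph \<Rightarrow> 'a \<Rightarrow> 'a set" where
  "nbrs G u = {w. (u, w) \<in> parcs G}"

definition edge_regular :: "'a pair_pre_digraph \<Rightarrow> nat \<Rightarrow> nat \<Rightarrow> nat \<Rightarrow> bool" where
  "edge_regular G v k l \<longleftrightarrow>
     pair_graph G \<and> 2 \<le> v \<and> 1 \<le> k \<and> card (pverts G) = v \<and>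
     (\<forall>x\<in>pverts G. card (nbrs G x) = k) \<and>
     (\<forall>x\<in>pverts G. \<forall>y\<in>pverts G. (x, y) \<in> parcs G \<longrightarrow> card (nbrs G x \<inter> nbrs G y) = l)"

definition strongly_regular :: "'a pair_pre_digraph \<Rightarrow> nat \<Rightarrow> nat \<Rightarrow> nat \<Rightarrow> nat \<Rightarrow> bool" where
  "strongly_regular G v k l m \<longleftrightarrow>
     edge_regular G v k l \<and>
     (\<forall>x\<in>pverts G. \<forall>y\<in>pverts G. x \<noteq> y \<and> (x, y) \<notin> parcs G \<longrightarrow> card (nbrs G x \<inter> nbrs G y) = m)"

definition independent_set :: "'a pair_pre_digraph \<Rightarrow> 'a set \<Rightarrow> bool" where
  "independent_set G S \<longleftrightarrow> S \<subseteq> pverts G \<and> (\<forall>x\<in>S. \<forall>y\<in>S. (x, y) \<notin> parcs G)"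


section \<open>The rook graph and the Shrikhande graph\<close>

definition complete_graph :: "nat \<Rightarrow> nat pair_pre_digraph" where
  "complete_graph n = \<lparr> pverts = {..<n}, parcs = {(x, y). x < n \<and> y < n \<and> x \<noteq> y} \<rparr>"

definition cartesian_product ::
    "'a pair_pre_digraph \<Rightarrow> 'b pair_pre_digraph \<Rightarrow> ('a \<times> 'b) pair_pre_digraph" where
  "cartesian_product G H =
     \<lparr> pverts = pverts G \<times> pverts H,
       parcs = {((a, b), (c, d)). a \<in> pverts G \<and> c \<in> pverts G \<and> b \<in> pverts H \<and> d \<in> pverts H \<and>
                  (a = c \<and> (b, d) \<in> parcs H \<or> (a, c) \<in> parcs G \<and> b = d)} \<rparr>"

definition rook_graph_4 :: "(nat \<times> nat) pair_pre_digraph" where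
  "rook_graph_4 = cartesian_product (complete_graph 4) (complete_graph 4)"

text \<open>
  The Shrikhande graph is given only up to isomorphism, as the unique strongly regular graph with
  parameters \<open>(16,6,2,2)\<close> that is not isomorphic to the rook graph. The defining property is
  invariant under isomorphism, so it says that \<open>G\<close> is isomorphic to the Shrikhande graph.
\<close>

definition is_shrikhande_graph :: "'a pair_pre_digraph \<Rightarrow> bool" where
  "is_shrikhande_graph G \<longleftrightarrow>
     strongly_regular G 16 6 2 2 \<and> \<not> digraph_iso (with_proj G) (with_proj rook_graph_4)"


section \<open>Construction data\<close>

text \<open>
  The set \<open>\<omega>\<^sup>\<phi>\<close>. Since the elements of a partition \<open>\<P>\<close> are nonempty and disjoint, the
  elements of \<open>\<P>\<close> whose union is \<open>\<omega>\<close> are exactly those contained in \<open>\<omega>\<close>.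
\<close>

definition induced_map :: "'a set set \<Rightarrow> ('a set \<Rightarrow> 'a set) \<Rightarrow> 'a set \<Rightarrow> 'a set" where
  "induced_map \<P> \<phi> \<omega> = \<Union> (\<phi> ` {P \<in> \<P>. P \<subseteq> \<omega>})"

definition admissible_bijection ::
    "'a set set \<Rightarrow> 'a set set \<Rightarrow> 'a set set \<Rightarrow> 'a set set \<Rightarrow> ('a set \<Rightarrow> 'a set) \<Rightarrow> bool" where
  "admissible_bijection \<P> \<Omega> \<Q> \<Omega>' \<phi> \<longleftrightarrow>
     bij_betw \<phi> \<P> \<Q> \<and> (\<forall>\<omega>\<in>\<Omega>. induced_map \<P> \<phi> \<omega> \<in> \<Omega>')"

text \<open>
  The functions \<open>\<Gamma>\<close>, \<open>\<Omega>\<close>, \<open>\<P>\<close>, \<open>\<P>'\<close> are only relevant at the indices \<open>1\<close>, \<open>2\<close>, \<open>3\<close>;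
  \<open>l\<close> and \<open>m\<close> stand for \<open>\<lambda>\<close> and \<open>\<mu>\<close>.
\<close>

locale construction_data =
  fixes l m :: nat
    and \<Gamma> :: "nat \<Rightarrow> 'a pair_pre_digraph"
    and \<Omega> \<P> \<P>' :: "nat \<Rightarrow> 'a set set"
    and \<phi>12 \<phi>23 \<phi>31 :: "'a set \<Rightarrow> 'a set"
  assumes l_pos: "0 < l" and m_pos: "0 < m" and m_dvd: "m dvd l + 2"
    and edge_regular: "i \<in> {1, 2, 3} \<Longrightarrow> edge_regular (\<Gamma> i) (m * l * (l + 2)) (l * (m + 1)) l"
    and disjoint_verts:
      "i \<in> {1, 2, 3} \<Longrightarrow> j \<in> {1, 2, 3} \<Longrightarrow> i \<noteq> j \<Longrightarrow> pverts (\<Gamma> i) \<inter> pverts (\<Gamma> j) = {}"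
    and \<Omega>_partition: "i \<in> {1, 2, 3} \<Longrightarrow> partition_on (pverts (\<Gamma> i)) (\<Omega> i)"
    and \<Omega>_number: "i \<in> {1, 2, 3} \<Longrightarrow> card (\<Omega> i) = (l + 2) div m"
    and \<Omega>_size: "i \<in> {1, 2, 3} \<Longrightarrow> \<omega> \<in> \<Omega> i \<Longrightarrow> card \<omega> = m^2 * l"
    and \<P>_partition: "i \<in> {1, 2, 3} \<Longrightarrow> \<R> \<in> {\<P> i, \<P>' i} \<Longrightarrow> partition_on (pverts (\<Gamma> i)) \<R>"
    and \<P>_number: "i \<in> {1, 2, 3} \<Longrightarrow> \<R> \<in> {\<P> i, \<P>' i} \<Longrightarrow> card \<R> = m * ((l + 2) div m)"
    and \<P>_size: "i \<in> {1, 2, 3} \<Longrightarrow> \<R> \<in> {\<P> i, \<P>' i} \<Longrightarrow> P \<in> \<R> \<Longrightarrow> card P = m * l"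
    and \<P>_independent:
      "i \<in> {1, 2, 3} \<Longrightarrow> \<R> \<in> {\<P> i, \<P>' i} \<Longrightarrow> P \<in> \<R> \<Longrightarrow> independent_set (\<Gamma> i) P"
    and \<Omega>_union:
      "i \<in> {1, 2, 3} \<Longrightarrow> \<R> \<in> {\<P> i, \<P>' i} \<Longrightarrow> \<omega> \<in> \<Omega> i \<Longrightarrow> \<exists>S \<subseteq> \<R>. card S = m \<and> \<omega> = \<Union> S"
    and intersection_size:
      "i \<in> {1, 2, 3} \<Longrightarrow> \<omega> \<in> \<Omega> i \<Longrightarrow> P \<in> \<P> i \<Longrightarrow> P' \<in> \<P>' i \<Longrightarrow> P \<subseteq> \<omega> \<Longrightarrow> P' \<subseteq> \<omega> \<Longrightarrow>
       card (P \<inter> P') = l"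
    and admissible_12: "admissible_bijection (\<P> 1) (\<Omega> 1) (\<P>' 2) (\<Omega> 2) \<phi>12"
    and admissible_23: "admissible_bijection (\<P> 2) (\<Omega> 2) (\<P>' 3) (\<Omega> 3) \<phi>23"
    and admissible_31: "admissible_bijection (\<P> 3) (\<Omega> 3) (\<P>' 1) (\<Omega> 1) \<phi>31"
    and composition_id:
      "\<omega> \<in> \<Omega> 1 \<Longrightarrow>
       induced_map (\<P> 3) \<phi>31 (induced_map (\<P> 2) \<phi>23 (induced_map (\<P> 1) \<phi>12 \<omega>)) = \<omega>"

definition cross_arcs :: "'a set set \<Rightarrow> ('a set \<Rightarrow> 'a set) \<Rightarrow> 'a rel" where
  "cross_arcs \<P> \<phi> = {(v, w). \<exists>P\<in>\<P>. v \<in> P \<and> w \<in> \<phi> P}"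

definition joined_graph ::
    "(nat \<Rightarrow> 'a pair_pre_digraph) \<Rightarrow> (nat \<Rightarrow> 'a set set) \<Rightarrow>
     ('a set \<Rightarrow> 'a set) \<Rightarrow> ('a set \<Rightarrow> 'a set) \<Rightarrow> ('a set \<Rightarrow> 'a set) \<Rightarrow> 'a pair_pre_digraph" where
  "joined_graph \<Gamma> \<P> \<phi>12 \<phi>23 \<phi>31 =
     (let C = cross_arcs (\<P> 1) \<phi>12 \<union> cross_arcs (\<P> 2) \<phi>23 \<union> cross_arcs (\<P> 3) \<phi>31
      in \<lparr> pverts = pverts (\<Gamma> 1) \<union> pverts (\<Gamma> 2) \<union> pverts (\<Gamma> 3),
           parcs = parcs (\<Gamma> 1) \<union> parcs (\<Gamma> 2) \<union> parcs (\<Gamma> 3) \<union> C \<union> C\<inverse> \<rparr>)"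


section \<open>Adjacency matrix and spectrum\<close>

definition adjacency_matrix :: "'a pair_pre_digraph \<Rightarrow> 'a list \<Rightarrow> real mat" where
  "adjacency_matrix G vs =
     mat (length vs) (length vs) (\<lambda>(i, j). if (vs ! i, vs ! j) \<in> parcs G then 1 else 0)"

text \<open>
  Real roots suffice: adjacency matrices of undirected graphs are symmetric, so all their
  eigenvalues are real and the algebraic and geometric multiplicities agree.
\<close>

definition eigenvalue_mset :: "real mat \<Rightarrow> real multiset" where
  "eigenvalue_mset A = proots (char_poly A)"

end

theory Submission
  imports Defs "Jordan_Normal_Form.Schur_Decomposition"
begin

text \<open>
  The adjacency matrix splits as \<open>M = D + B\<close>, with \<open>D\<close> the block diagonal part coming from the
  three graphs \<open>\<Gamma>\<^sub>i\<close> and \<open>B\<close> the part coming from the edges between them. Both the rook graph and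
  the Shrikhande graph are strongly regular with parameters \<open>(16,6,2,2)\<close>, and the argument is the
  same for every such graph. A coclique of size 4 in such a graph meets the Hoffman bound, hence every vertex
  outside it has exactly 2 neighbours in it (\<open>hoffman_coclique\<close>). So the partitions into
  cocliques are equitable for \<open>D\<close>; this makes \<open>D\<close> and \<open>B\<close> commute and determines \<open>D * B\<close>.

  The cycle of induced maps being the identity means that the six cells (the elements of the
  \<open>\<Omega>\<^sub>i\<close>) fall into two components with one cell in each \<open>V\<^sub>i\<close>. With \<open>I\<close> the identity, the
  following kernels, each a combination of indicators of relations between two vertices, span a
  space that is closed under multiplication by \<open>M\<close>:
  \<open>I\<close>, \<open>D\<close>, \<open>B\<close>, \<open>J\<close> (same \<open>V\<^sub>i\<close>), \<open>K\<close> (different \<open>V\<^sub>i\<close>), \<open>S\<close> (same element of \<open>\<P>\<^sub>i\<close> plus same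
  element of \<open>\<P>'\<^sub>i\<close>), \<open>F\<close> (same cell), \<open>W\<close> (same component, different cell).
  Double counting gives the multiplication table
  \<open>D*M = 4I + 2J - 2B + 2K\<close>, \<open>B*M = -2B + 2K + 4S + 2W\<close>, \<open>J*M = 6J + 4K\<close>, \<open>K*M = 8J + 10K\<close>,
  \<open>S*M = 4B - 2S + 4J + 2W\<close>, \<open>F*M = 4J - 2F + 4W\<close>, \<open>W*M = 4K + 8F + 2W\<close>
  (\<open>ker_mult_joined\<close>).

  Consequently the powers of \<open>M\<close> are explicit, \<open>(M-14)(M-6)(M-2)(M+2)(M+6) = 0\<close>, and the traces of
  \<open>M\<^sup>0,\<dots>,M\<^sup>4\<close> are \<open>48, 0, 672, 1344, 50688\<close>. By Schur triangularisation over the complex numbers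
  the trace of \<open>M\<^sup>k\<close> is the sum of the \<open>k\<close>-th powers of the roots of the characteristic polynomial
  (\<open>trace_pow_eq_power_sum\<close>). All roots lie among five known numbers, so these five power sums
  form a Vandermonde system for the multiplicities (\<open>mset_from_power_sums\<close>).
\<close>

section \<open>Traces of powers and the characteristic polynomial\<close>

definition mat_trace :: "'a::comm_monoid_add mat \<Rightarrow> 'a" where
  "mat_trace A = (\<Sum>i<dim_row A. A $$ (i, i))"

lemma mat_trace_mult_commute:
  fixes A B :: "'a::comm_semiring_0 mat"
  assumes "A \<in> carrier_mat n m" "B \<in> carrier_mat m n"
  shows "mat_trace (A * B) = mat_trace (B * A)"
proof -
  have "mat_trace (A * B) = (\<Sum>i<n. \<Sum>j<m. A $$ (i, j) * B $$ (j, i))"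
    using assms by (auto simp: mat_trace_def scalar_prod_def atLeast0LessThan intro!: sum.cong)
  also have "\<dots> = (\<Sum>j<m. \<Sum>i<n. B $$ (j, i) * A $$ (i, j))"
    by (subst sum.swap) (simp add: mult.commute)
  also have "\<dots> = mat_trace (B * A)"
    using assms by (auto simp: mat_trace_def scalar_prod_def atLeast0LessThan intro!: sum.cong)
  finally show ?thesis .
qed

lemma similar_mat_wit_trace:
  fixes A B :: "'a::comm_ring_1 mat"
  assumes "similar_mat_wit A B P Q"
  shows "mat_trace A = mat_trace B"
proof -
  define n where "n = dim_row A"
  from similar_mat_witD[OF n_def assms]
  have *: "Q * P = 1\<^sub>m n" "A = P * B * Q" "B \<in> carrier_mat n n" "P \<in> carrier_mat n n"
    "Q \<in> carrier_mat n n" by auto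
  have "mat_trace A = mat_trace (Q * (P * B))"
    unfolding *(2) by (rule mat_trace_mult_commute) (use * in auto)
  also have "Q * (P * B) = (Q * P) * B"
    by (rule assoc_mult_mat[symmetric]) (use * in auto)
  also have "\<dots> = B" using * by simp
  finally show ?thesis .
qed

text \<open>
  On the diagonal of a product of upper triangular matrices only the product of the diagonal
  entries survives; upper triangularity is carried along because the induction needs it.
\<close>

lemma upper_triangular_pow:
  fixes B :: "'a::comm_ring_1 mat"
  assumes B: "B \<in> carrier_mat n n" and up: "upper_triangular B"
  shows "upper_triangular (B ^\<^sub>m k) \<and> (\<forall>i<n. (B ^\<^sub>m k) $$ (i, i) = (B $$ (i, i)) ^ k)"
proof (induction k)
  case 0
  then show ?case using B by auto
next
  case (Suc k)
  define C where "C = B ^\<^sub>m k"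
  have C: "C \<in> carrier_mat n n" using B by (simp add: C_def)
  have Cup: "upper_triangular C" and Cd: "\<And>i. i < n \<Longrightarrow> C $$ (i, i) = (B $$ (i, i)) ^ k"
    using Suc by (auto simp: C_def)
  have ent: "(C * B) $$ (i, j) = (\<Sum>l<n. C $$ (i, l) * B $$ (l, j))" if "i < n" "j < n" for i j
    using that B C by (auto simp: scalar_prod_def atLeast0LessThan intro!: sum.cong)
  \<comment> \<open>a nonzero summand needs \<open>i \<le> l \<le> j\<close>\<close>
  have z: "C $$ (i, l) * B $$ (l, j) = 0" if "i < n" "l < n" "j < n" "l < i \<or> j < l" for i l j
    using that up Cup B C by (auto simp: upper_triangular_def)
  have "(C * B) $$ (i, j) = 0" if "i < n" "j < i" for i j
    unfolding ent[OF that(1) less_trans[OF that(2,1)]]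
    using that z by (intro sum.neutral) (metis lessThan_iff linorder_neqE_nat less_trans)
  moreover have "(C * B) $$ (i, i) = (B $$ (i, i)) ^ Suc k" if i: "i < n" for i
  proof -
    have "(C * B) $$ (i, i) = (\<Sum>l\<in>{i}. C $$ (i, l) * B $$ (l, i))"
      unfolding ent[OF i i] using z i by (intro sum.mono_neutral_right) (auto simp: neq_iff)
    then show ?thesis using Cd[OF i] by simp
  qed
  ultimately show ?case using B C by (auto simp: C_def[symmetric] upper_triangular_def)
qed

text \<open>
  The trace is a similarity invariant, so it can be read off a Schur triangular form, whose
  diagonal lists the roots with multiplicity.
\<close>

lemma trace_pow_eq_power_sum:
  fixes A :: "complex mat"
  assumes A: "A \<in> carrier_mat n n" and fact: "char_poly A = (\<Prod>e\<leftarrow>es. [:- e, 1:])"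
  shows "mat_trace (A ^\<^sub>m k) = (\<Sum>e\<leftarrow>es. e ^ k)"
proof -
  obtain B P Q where "schur_decomposition A es = (B, P, Q)"
    by (cases "schur_decomposition A es") auto
  from schur_decomposition[OF A fact this]
  have wit: "similar_mat_wit A B P Q" and up: "upper_triangular B" and es: "diag_mat B = es"
    by auto
  from similar_mat_witD2[OF A wit] have B: "B \<in> carrier_mat n n" by auto
  have "mat_trace (A ^\<^sub>m k) = mat_trace (B ^\<^sub>m k)"
    by (rule similar_mat_wit_trace[OF similar_mat_wit_pow[OF wit]])
  also have "\<dots> = (\<Sum>i<n. (B $$ (i, i)) ^ k)"
    using upper_triangular_pow[OF B up, of k] B by (simp add: mat_trace_def)
  also have "\<dots> = (\<Sum>e\<leftarrow>es. e ^ k)"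
    using B by (auto simp: es[symmetric] diag_mat_def sum_list_sum_nth atLeast0LessThan comp_def)
  finally show ?thesis .
qed

text \<open>
  Apply the vanishing combination of powers to an eigenvector. The hypothesis is stated entrywise
  because the powers are later known through their entries.
\<close>

lemma eigenvalue_annihilates:
  fixes A :: "'a::field mat"
  assumes A: "A \<in> carrier_mat n n"
    and ann: "\<And>i j. i < n \<Longrightarrow> j < n \<Longrightarrow> (\<Sum>k<m. c k * (A ^\<^sub>m k) $$ (i, j)) = 0"
    and root: "poly (char_poly A) e = 0"
  shows "(\<Sum>k<m. c k * e ^ k) = 0"
proof -
  from root A have "eigenvalue A e" by (simp add: eigenvalue_root_char_poly)
  then obtain v where ev: "eigenvector A v e" by (auto simp: eigenvalue_def)
  then have v: "v \<in> carrier_vec n" and "v \<noteq> 0\<^sub>v n" using A by (auto simp: eigenvector_def)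
  then obtain i where i: "i < n" "v $ i \<noteq> 0" by (metis eq_vecI carrier_vecD index_zero_vec)
  have pw: "(\<Sum>j<n. (A ^\<^sub>m k) $$ (i, j) * v $ j) = e ^ k * v $ i" for k
  proof -
    have "(A ^\<^sub>m k *\<^sub>v v) $ i = (\<Sum>j<n. (A ^\<^sub>m k) $$ (i, j) * v $ j)"
      using i v A by (simp add: scalar_prod_def atLeast0LessThan pow_mat_dim_square)
    then show ?thesis using eigenvector_pow[OF A ev, of k] i v by simp
  qed
  have "(\<Sum>k<m. c k * e ^ k) * v $ i = (\<Sum>k<m. c k * (\<Sum>j<n. (A ^\<^sub>m k) $$ (i, j) * v $ j))"
    by (simp add: pw sum_distrib_right mult.assoc)
  also have "\<dots> = (\<Sum>j<n. (\<Sum>k<m. c k * (A ^\<^sub>m k) $$ (i, j)) * v $ j)"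
    unfolding sum_distrib_left sum_distrib_right by (subst sum.swap) (simp add: mult.assoc)
  also have "\<dots> = 0" using ann i by simp
  finally show ?thesis using i by simp
qed

text \<open>
  The factorisation into linear factors exists over the complex numbers. An annihilating
  polynomial with only real roots forces all linear factors to be real, which brings the
  factorisation back to the reals.
\<close>

lemma real_spectrum_of_annihilated_mat:
  fixes A :: "real mat"
  assumes A: "A \<in> carrier_mat n n"
    and ann: "\<And>i j. i < n \<Longrightarrow> j < n \<Longrightarrow> (\<Sum>k<m. c k * (A ^\<^sub>m k) $$ (i, j)) = 0"
    and split: "\<And>z. (\<Sum>k<m. complex_of_real (c k) * z ^ k) = 0 \<Longrightarrow> z \<in> complex_of_real ` R"
  obtains rs where "set rs \<subseteq> R" "eigenvalue_mset A = mset rs"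
    "\<And>k. mat_trace (A ^\<^sub>m k) = (\<Sum>r\<leftarrow>rs. r ^ k)"
proof -
  let ?A = "map_mat complex_of_real A"
  note mat_hom_pow = of_real_hom.mat_hom_pow[where ?'a = complex]
  note cp_hom = of_real_hom.char_poly_hom[where ?'a = complex]
  have A': "?A \<in> carrier_mat n n" using A by simp
  from char_poly_factorized[OF A'] obtain es where
    es: "char_poly ?A = (\<Prod>e\<leftarrow>es. [:- e, 1:])" by blast
  have pw: "(?A ^\<^sub>m k) = map_mat complex_of_real (A ^\<^sub>m k)" for k
    using mat_hom_pow[OF A, of k] by simp
  have pwi: "(?A ^\<^sub>m k) $$ (i, j) = complex_of_real ((A ^\<^sub>m k) $$ (i, j))" if "i < n" "j < n" for i j k
    using that A pow_carrier_mat[OF A, of k] by (simp add: pw)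
  have "set es \<subseteq> complex_of_real ` R"
  proof
    fix e assume "e \<in> set es"
    then have "poly (char_poly ?A) e = 0"
      by (auto simp: es poly_prod_list prod_list_zero_iff)
    from eigenvalue_annihilates[OF A' _ this, where c = "\<lambda>k. complex_of_real (c k)" and m = m]
    have "(\<Sum>k<m. complex_of_real (c k) * e ^ k) = 0"
      using ann by (simp add: pwi flip: of_real_mult of_real_sum)
    then show "e \<in> complex_of_real ` R" by (rule split)
  qed
  define rs where "rs = map Re es"
  have "map (complex_of_real \<circ> Re) es = es"
    by (rule map_idI) (use \<open>set es \<subseteq> complex_of_real ` R\<close> in auto)
  then have es_rs: "es = map complex_of_real rs" and "set rs \<subseteq> R"
    using \<open>set es \<subseteq> complex_of_real ` R\<close> by (auto simp: rs_def)
  interpret hp: map_poly_inj_comm_ring_hom "of_real :: real \<Rightarrow> complex" ..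
  have "map_poly complex_of_real (char_poly A) = map_poly complex_of_real (\<Prod>r\<leftarrow>rs. [:- r, 1:])"
    unfolding cp_hom[OF A, symmetric] es es_rs by (simp add: hp.hom_prod_list o_def)
  then have cp: "char_poly A = (\<Prod>r\<leftarrow>rs. [:- r, 1:])" by simp
  have "eigenvalue_mset A = mset rs"
    unfolding eigenvalue_mset_def cp
  proof (induction rs)
    case (Cons r rs)
    have "(\<Prod>r\<leftarrow>rs. [:- r, 1:]) \<noteq> (0 :: real poly)" by (auto simp: prod_list_zero_iff)
    then show ?case using Cons by (simp add: proots_mult del: mult_pCons_left)
  qed simp
  moreover have "mat_trace (A ^\<^sub>m k) = (\<Sum>r\<leftarrow>rs. r ^ k)" for k
  proof -
    have "complex_of_real (mat_trace (A ^\<^sub>m k)) = mat_trace (?A ^\<^sub>m k)"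
      using A by (simp add: mat_trace_def pw)
    also have "\<dots> = complex_of_real (\<Sum>r\<leftarrow>rs. r ^ k)"
      unfolding trace_pow_eq_power_sum[OF A' es] es_rs by (induction rs) auto
    finally show ?thesis by (simp only: of_real_eq_iff)
  qed
  ultimately show ?thesis using that \<open>set rs \<subseteq> R\<close> by blast
qed

section \<open>Cocliques meeting the Hoffman bound\<close>

text \<open>
  A variance argument. Let \<open>d x\<close> count the neighbours of \<open>x\<close> in the coclique \<open>C\<close>. Counting edges
  between \<open>C\<close> and its complement gives sum 24 for \<open>d\<close> over the 12 outside vertices, and counting
  pairs of edges gives sum 48 for \<open>d\<^sup>2\<close>. Hence the sum of \<open>(d - 2)\<^sup>2\<close> is \<open>48 - 96 + 48 = 0\<close>.
\<close>

lemma hoffman_coclique: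
  fixes adj :: "'a \<Rightarrow> 'a \<Rightarrow> bool"
  assumes "card X = 16" and sym: "\<And>x y. x \<in> X \<Longrightarrow> y \<in> X \<Longrightarrow> adj x y \<Longrightarrow> adj y x"
    and degree: "\<And>x. x \<in> X \<Longrightarrow> card {z \<in> X. adj x z} = 6"
    and common: "\<And>x y. x \<in> X \<Longrightarrow> y \<in> X \<Longrightarrow> x \<noteq> y \<Longrightarrow> card {z \<in> X. adj x z \<and> adj z y} = 2"
    and C: "C \<subseteq> X" "card C = 4" "\<And>x y. x \<in> C \<Longrightarrow> y \<in> C \<Longrightarrow> \<not> adj x y"
    and x: "x \<in> X - C"
  shows "card {z \<in> C. adj x z} = 2"
proof -
  have fin: "finite X" "finite C" using assms by (auto intro: card_ge_0_finite finite_subset)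
  define d where "d x = (\<Sum>z\<in>C. of_bool (adj x z) :: int)" for x
  have adj_outside: "{x \<in> X - C. adj x z \<and> Q x} = {x \<in> X. adj z x \<and> Q x}" if "z \<in> C" for z Q
    using C that sym by blast
  have "(\<Sum>x\<in>X-C. d x) = (\<Sum>z\<in>C. int (card {x \<in> X - C. adj x z}))"
    unfolding d_def by (subst sum.swap) (simp add: fin Int_def)
  also have "\<dots> = (\<Sum>z\<in>C. 6)"
    using adj_outside[of _ "\<lambda>_. True"] degree C by (intro sum.cong) auto
  finally have sum1: "(\<Sum>x\<in>X-C. d x) = 24" using C by simp
  have pair: "card {x \<in> X - C. adj x z \<and> adj x w} = (if w = z then 6 else 2)"
    if "z \<in> C" "w \<in> C" for z w
  proof -
    have "card {x \<in> X - C. adj x z \<and> adj x w} = card {x \<in> X. adj z x \<and> adj x w}"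
      using adj_outside[OF that(1), of "\<lambda>x. adj x w"] by simp
    moreover have "{x \<in> X. adj z x \<and> adj x z} = {x \<in> X. adj z x}"
      using sym C that by blast
    moreover have "z \<in> X" "w \<in> X" using C that by auto
    ultimately show ?thesis using degree[of z] common[of z w] by auto
  qed
  have "(\<Sum>x\<in>X-C. d x * d x) = (\<Sum>x\<in>X-C. \<Sum>z\<in>C. \<Sum>w\<in>C. of_bool (adj x z \<and> adj x w))"
    by (simp add: d_def sum_product of_bool_conj)
  also have "\<dots> = (\<Sum>z\<in>C. \<Sum>x\<in>X-C. \<Sum>w\<in>C. of_bool (adj x z \<and> adj x w))"
    by (rule sum.swap)
  also have "\<dots> = (\<Sum>z\<in>C. \<Sum>w\<in>C. \<Sum>x\<in>X-C. of_bool (adj x z \<and> adj x w))"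
    by (intro sum.cong refl sum.swap)
  also have "\<dots> = (\<Sum>z\<in>C. \<Sum>w\<in>C. int (card {x \<in> X - C. adj x z \<and> adj x w}))"
    by (simp add: fin Int_def)
  also have "\<dots> = (\<Sum>z\<in>C. \<Sum>w\<in>C. 2 + (if w = z then 4 else 0))"
    using pair by (intro sum.cong refl) auto
  also have "\<dots> = 48" using fin C by (simp add: sum.distrib)
  finally have sum2: "(\<Sum>x\<in>X-C. d x * d x) = 48" .
  have "(\<Sum>x\<in>X-C. (d x - 2) * (d x - 2)) = (\<Sum>x\<in>X-C. d x * d x) - 4 * (\<Sum>x\<in>X-C. d x) + 4 * int (card (X - C))"
    by (simp add: algebra_simps sum.distrib sum_subtractf sum_distrib_left)
  also have "\<dots> = 0" using sum1 sum2 assms fin by (simp add: card_Diff_subset)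
  finally have "(d x - 2) * (d x - 2) = 0"
    using x fin by (subst (asm) sum_nonneg_eq_0_iff) auto
  then have "d x = 2" by simp
  then show ?thesis by (simp add: d_def fin Int_def)
qed

section \<open>Three linked strongly regular graphs\<close>

text \<open>
  The situation with all sets encoded by labels of vertices: \<open>blk x\<close> tells in which of the three
  graphs \<open>x\<close> lies, \<open>p x\<close> and \<open>q x\<close> name the cocliques of the two partitions that contain \<open>x\<close>, and
  \<open>cmp x\<close> is the component of its cell. The label \<open>q\<close> names the element of \<open>\<P>'\<^sub>j\<close> by its preimage
  under the bijection \<open>\<phi>\<^sub>i\<^sub>j\<close>, so vertices \<open>x\<close> of block \<open>i\<close> and \<open>y\<close> of block \<open>j\<close> are joined iff
  \<open>q y = p x\<close>. Blocks are numbered modulo 3 to make the cyclic shift from \<open>i\<close> to \<open>j\<close> a successor.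
\<close>

locale linked_triple =
  fixes V :: "'a set" and adj :: "'a \<Rightarrow> 'a \<Rightarrow> bool" and blk :: "'a \<Rightarrow> nat"
    and p q :: "'a \<Rightarrow> 'c" and cmp :: "'a \<Rightarrow> 'd"
  assumes fin: "finite V"
    and blk_less: "x \<in> V \<Longrightarrow> blk x < 3"
    and card_blk: "i < 3 \<Longrightarrow> card {z \<in> V. blk z = i} = 16"
    and card_cell: "x \<in> V \<Longrightarrow> card {z \<in> V. blk z = blk x \<and> cmp z = cmp x} = 8"
    and p_refines: "x \<in> V \<Longrightarrow> y \<in> V \<Longrightarrow> p x = p y \<Longrightarrow> blk x = blk y \<and> cmp x = cmp y"
    and q_refines: "x \<in> V \<Longrightarrow> y \<in> V \<Longrightarrow> q x = q y \<Longrightarrow> blk x = blk y \<and> cmp x = cmp y"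
    and card_p: "x \<in> V \<Longrightarrow> card {z \<in> V. p z = p x} = 4"
    and card_q: "x \<in> V \<Longrightarrow> card {z \<in> V. q z = q x} = 4"
    and card_pq: "x \<in> V \<Longrightarrow> y \<in> V \<Longrightarrow> blk x = blk y \<Longrightarrow> cmp x = cmp y \<Longrightarrow>
      card {z \<in> V. p z = p x \<and> q z = q y} = 2"
    and succ_ex: "x \<in> V \<Longrightarrow> \<exists>y\<in>V. q y = p x"
    and pred_ex: "x \<in> V \<Longrightarrow> \<exists>y\<in>V. p y = q x"
    and link: "x \<in> V \<Longrightarrow> y \<in> V \<Longrightarrow> q y = p x \<Longrightarrow> blk y = Suc (blk x) mod 3 \<and> cmp y = cmp x"
    and adj_sym: "x \<in> V \<Longrightarrow> y \<in> V \<Longrightarrow> adj x y \<Longrightarrow> adj y x"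
    and adj_blk: "x \<in> V \<Longrightarrow> y \<in> V \<Longrightarrow> adj x y \<Longrightarrow> blk x = blk y"
    and card_adj: "x \<in> V \<Longrightarrow> card {z \<in> V. adj x z} = 6"
    and card_common: "x \<in> V \<Longrightarrow> y \<in> V \<Longrightarrow> x \<noteq> y \<Longrightarrow> blk x = blk y \<Longrightarrow>
      card {z \<in> V. adj x z \<and> adj z y} = 2"
    and p_coclique: "x \<in> V \<Longrightarrow> y \<in> V \<Longrightarrow> p x = p y \<Longrightarrow> \<not> adj x y"
    and q_coclique: "x \<in> V \<Longrightarrow> y \<in> V \<Longrightarrow> q x = q y \<Longrightarrow> \<not> adj x y"
begin

definition tally :: "('a \<Rightarrow> bool) \<Rightarrow> real" where
  "tally P = (\<Sum>z\<in>V. of_bool (P z))"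

lemma tally_card: "tally P = real (card {z \<in> V. P z})"
  by (simp add: tally_def fin Int_def)

text \<open>
  On each class that gets counted the second condition has a constant truth value.
\<close>

lemma tally_const:
  assumes "\<And>z. z \<in> V \<Longrightarrow> P z \<Longrightarrow> Q z = b"
  shows "tally (\<lambda>z. P z \<and> Q z) = tally P * of_bool b"
  unfolding tally_def sum_distrib_right using assms by (intro sum.cong) auto

lemma tally_p: "a \<in> V \<Longrightarrow> tally (\<lambda>z. p z = p a) = 4"
  and tally_q: "a \<in> V \<Longrightarrow> tally (\<lambda>z. q z = q a) = 4"
  and tally_adj: "a \<in> V \<Longrightarrow> tally (adj a) = 6"
  by (simp_all add: tally_card card_p card_q card_adj)

lemma tally_pp:
  assumes "a \<in> V"
  shows "tally (\<lambda>z. p z = p a \<and> p z = p b) = 4 * of_bool (p a = p b)"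
  unfolding tally_p[OF assms, symmetric] by (rule tally_const) simp

lemma tally_qq:
  assumes "a \<in> V"
  shows "tally (\<lambda>z. q z = q a \<and> q z = q b) = 4 * of_bool (q a = q b)"
  unfolding tally_q[OF assms, symmetric] by (rule tally_const) simp

lemma tally_pq:
  assumes "a \<in> V" "b \<in> V"
  shows "tally (\<lambda>z. p z = p a \<and> q z = q b) = 2 * of_bool (blk a = blk b \<and> cmp a = cmp b)"
proof (cases "blk a = blk b \<and> cmp a = cmp b")
  case True
  then show ?thesis using assms by (simp add: tally_card card_pq)
next
  case False
  have "False" if z: "z \<in> V" "p z = p a" "q z = q b" for z
    using p_refines[OF z(1) assms(1) z(2)] q_refines[OF z(1) assms(2) z(3)] False by simp
  then have empty: "{z \<in> V. p z = p a \<and> q z = q b} = {}" by blast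
  show ?thesis unfolding tally_card empty using False by simp
qed

lemma tally_qp:
  assumes "a \<in> V" "b \<in> V"
  shows "tally (\<lambda>z. q z = q b \<and> p z = p a) = 2 * of_bool (blk a = blk b \<and> cmp a = cmp b)"
  using tally_pq[OF assms] by (simp add: conj_commute)

lemma tally_p_blk:
  assumes "a \<in> V"
  shows "tally (\<lambda>z. p z = p a \<and> blk z = i) = 4 * of_bool (blk a = i)"
    and "tally (\<lambda>z. p z = p a \<and> blk z = i \<and> cmp z = c) = 4 * of_bool (blk a = i \<and> cmp a = c)"
proof -
  have "blk z = blk a \<and> cmp z = cmp a" if "z \<in> V" "p z = p a" for z
    by (rule p_refines) fact+
  then show "tally (\<lambda>z. p z = p a \<and> blk z = i) = 4 * of_bool (blk a = i)"
    and "tally (\<lambda>z. p z = p a \<and> blk z = i \<and> cmp z = c) = 4 * of_bool (blk a = i \<and> cmp a = c)"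
    unfolding tally_p[OF assms, symmetric] by (intro tally_const; simp)+
qed

lemma tally_q_blk:
  assumes "a \<in> V"
  shows "tally (\<lambda>z. q z = q a \<and> blk z = i) = 4 * of_bool (blk a = i)"
    and "tally (\<lambda>z. q z = q a \<and> blk z = i \<and> cmp z = c) = 4 * of_bool (blk a = i \<and> cmp a = c)"
proof -
  have "blk z = blk a \<and> cmp z = cmp a" if "z \<in> V" "q z = q a" for z
    by (rule q_refines) fact+
  then show "tally (\<lambda>z. q z = q a \<and> blk z = i) = 4 * of_bool (blk a = i)"
    and "tally (\<lambda>z. q z = q a \<and> blk z = i \<and> cmp z = c) = 4 * of_bool (blk a = i \<and> cmp a = c)"
    unfolding tally_q[OF assms, symmetric] by (intro tally_const; simp)+
qed

lemma tally_adj_blk: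
  assumes "a \<in> V"
  shows "tally (\<lambda>z. adj a z \<and> blk z = i) = 6 * of_bool (blk a = i)"
  unfolding tally_adj[OF assms, symmetric] by (rule tally_const) (simp add: adj_blk[OF assms])

lemma tally_adj_adj:
  assumes "a \<in> V" "b \<in> V"
  shows "tally (\<lambda>z. adj a z \<and> adj b z) = of_bool (blk a = blk b) * (2 + 4 * of_bool (a = b))"
proof -
  have *: "{z \<in> V. adj a z \<and> adj b z} = {z \<in> V. adj a z \<and> adj z b}" using assms adj_sym by blast
  consider "a = b" | "a \<noteq> b" "blk a = blk b" | "a \<noteq> b" "blk a \<noteq> blk b" by blast
  then show ?thesis
  proof cases
    case 1
    then show ?thesis using card_adj assms by (simp add: tally_card)
  next
    case 2
    then show ?thesis using card_common[OF assms] by (simp add: tally_card *)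
  next
    case 3
    have empty: "{z \<in> V. adj a z \<and> adj b z} = {}"
      using adj_blk[OF assms(1)] adj_blk[OF assms(2)] 3 by force
    show ?thesis unfolding tally_card empty using 3 by simp
  qed
qed

lemma card_adj_coclique:
  assumes a: "a \<in> V" and C: "C \<subseteq> {z \<in> V. blk z = blk a}" "card C = 4"
    "\<And>x y. x \<in> C \<Longrightarrow> y \<in> C \<Longrightarrow> \<not> adj x y" and "a \<notin> C"
  shows "card {z \<in> C. adj a z} = 2"
proof (rule hoffman_coclique[where X = "{z \<in> V. blk z = blk a}"])
  show "card {z \<in> {z \<in> V. blk z = blk a}. adj x z} = 6" if "x \<in> {z \<in> V. blk z = blk a}" for x
  proof -
    have "{z \<in> {z \<in> V. blk z = blk a}. adj x z} = {z \<in> V. adj x z}"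
      using that adj_blk[of x] by auto
    then show ?thesis using that card_adj by simp
  qed
  show "card {z \<in> {z \<in> V. blk z = blk a}. adj x z \<and> adj z y} = 2"
    if "x \<in> {z \<in> V. blk z = blk a}" "y \<in> {z \<in> V. blk z = blk a}" "x \<noteq> y" for x y
  proof -
    have "{z \<in> {z \<in> V. blk z = blk a}. adj x z \<and> adj z y} = {z \<in> V. adj x z \<and> adj z y}"
      using that adj_blk[of x] by auto
    then show ?thesis using that card_common[of x y] by simp
  qed
  show "card {z \<in> V. blk z = blk a} = 16" using card_blk blk_less a by simp
  show "adj y x" if "x \<in> {z \<in> V. blk z = blk a}" "y \<in> {z \<in> V. blk z = blk a}" "adj x y" for x y
    using that adj_sym by blast
qed (use assms in auto)

lemma tally_adj_p:
  assumes "a \<in> V" "b \<in> V"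
  shows "tally (\<lambda>z. adj a z \<and> p z = p b) = 2 * of_bool (blk a = blk b \<and> p a \<noteq> p b)"
proof -
  let ?C = "{z \<in> V. p z = p b}"
  have eq: "{z \<in> V. adj a z \<and> p z = p b} = {z \<in> ?C. adj a z}" by auto
  have "card {z \<in> ?C. adj a z} = 2" if "blk a = blk b" "p a \<noteq> p b"
  proof (rule card_adj_coclique)
    show "?C \<subseteq> {z \<in> V. blk z = blk a}"
      using p_refines[OF _ assms(2)] that(1) by (simp add: subset_iff)
    show "\<not> adj x y" if "x \<in> ?C" "y \<in> ?C" for x y
      using that p_coclique[of x y] by simp
  qed (use assms that card_p in auto)
  moreover have "card {z \<in> ?C. adj a z} = 0" if "\<not> (blk a = blk b \<and> p a \<noteq> p b)"
  proof -
    have False if z: "z \<in> V" "p z = p b" "adj a z" for z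
      using that p_refines[OF z(1) assms(2) z(2)] adj_blk[OF assms(1) z(1,3)]
        p_coclique[OF assms(1) z(1)] z \<open>\<not> (blk a = blk b \<and> p a \<noteq> p b)\<close> by auto
    then have "{z \<in> ?C. adj a z} = {}" by blast
    then show ?thesis by (simp only: card.empty)
  qed
  ultimately show ?thesis unfolding tally_card eq by auto
qed

lemma tally_adj_q:
  assumes "a \<in> V" "b \<in> V"
  shows "tally (\<lambda>z. adj a z \<and> q z = q b) = 2 * of_bool (blk a = blk b \<and> q a \<noteq> q b)"
proof -
  let ?C = "{z \<in> V. q z = q b}"
  have eq: "{z \<in> V. adj a z \<and> q z = q b} = {z \<in> ?C. adj a z}" by auto
  have "card {z \<in> ?C. adj a z} = 2" if "blk a = blk b" "q a \<noteq> q b"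
  proof (rule card_adj_coclique)
    show "?C \<subseteq> {z \<in> V. blk z = blk a}"
      using q_refines[OF _ assms(2)] that(1) by (simp add: subset_iff)
    show "\<not> adj x y" if "x \<in> ?C" "y \<in> ?C" for x y
      using that q_coclique[of x y] by simp
  qed (use assms that card_q in auto)
  moreover have "card {z \<in> ?C. adj a z} = 0" if "\<not> (blk a = blk b \<and> q a \<noteq> q b)"
  proof -
    have False if z: "z \<in> V" "q z = q b" "adj a z" for z
      using that q_refines[OF z(1) assms(2) z(2)] adj_blk[OF assms(1) z(1,3)]
        q_coclique[OF assms(1) z(1)] z \<open>\<not> (blk a = blk b \<and> q a \<noteq> q b)\<close> by auto
    then have "{z \<in> ?C. adj a z} = {}" by blast
    then show ?thesis by (simp only: card.empty)
  qed
  ultimately show ?thesis unfolding tally_card eq by auto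
qed

text \<open>
  A cell has 8 elements, so it is the union of two classes of \<open>p\<close> of size 4, to each of which the
  Hoffman count applies: \<open>0 + 2\<close> neighbours if the vertex lies in the cell, \<open>2 + 2\<close> otherwise.
\<close>

lemma tally_adj_cell:
  assumes "a \<in> V" "b \<in> V"
  shows "tally (\<lambda>z. adj a z \<and> blk z = blk b \<and> cmp z = cmp b) =
    of_bool (blk a = blk b) * (4 - 2 * of_bool (cmp a = cmp b))"
proof -
  let ?cell = "{z \<in> V. blk z = blk b \<and> cmp z = cmp b}"
  let ?P = "\<lambda>u. {z \<in> V. p z = p u}"
  have sub: "?P u \<subseteq> ?cell" if "u \<in> ?cell" for u using that p_refines[of _ u] by (simp add: subset_iff)
  have b: "b \<in> ?cell" using assms by simp
  have "card (?cell - ?P b) = 4"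
    by (subst card_Diff_subset[OF _ sub[OF b]]) (simp_all add: fin card_cell card_p assms)
  then have "?cell - ?P b \<noteq> {}" by (intro notI) (simp only: card.empty zero_neq_numeral)
  then obtain u where u: "u \<in> ?cell" "p u \<noteq> p b" by blast
  have "card (?P b \<union> ?P u) = 4 + 4"
    using u assms fin by (subst card_Un_disjoint) (auto simp: card_p)
  then have "?P b \<union> ?P u = ?cell"
    by (intro card_subset_eq Un_least sub b u(1)) (simp_all add: fin card_cell assms)
  then have cell: "z \<in> V \<Longrightarrow> blk z = blk b \<and> cmp z = cmp b \<longleftrightarrow> p z = p b \<or> p z = p u" for z
    by (auto simp: set_eq_iff)
  have "tally (\<lambda>z. adj a z \<and> blk z = blk b \<and> cmp z = cmp b) =
      tally (\<lambda>z. adj a z \<and> p z = p b) + tally (\<lambda>z. adj a z \<and> p z = p u)"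
    unfolding tally_def sum.distrib[symmetric] using u by (intro sum.cong) (auto simp: cell)
  moreover have "cmp a = cmp b \<longleftrightarrow> p a = p b \<or> p a = p u" if "blk a = blk b"
    using that cell[of a] assms by auto
  ultimately show ?thesis
    using u assms by (auto simp: tally_adj_p)
qed

end

section \<open>The algebra of the joined graph\<close>

context linked_triple
begin

text \<open>
  Representatives of the classes joined to \<open>x\<close>: the neighbours of \<open>x\<close> in the next block are the
  \<open>q\<close>-class of \<open>succ x\<close>, those in the previous block the \<open>p\<close>-class of \<open>pred x\<close>. With them every row of
  the kernels below is a sum of indicators of classes, blocks and cells of single vertices.
\<close>

definition succ where "succ x = (SOME y. y \<in> V \<and> q y = p x)"
definition pred where "pred x = (SOME y. y \<in> V \<and> p y = q x)"

lemma succ: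
  assumes "x \<in> V"
  shows "succ x \<in> V" "q (succ x) = p x" "blk (succ x) = Suc (blk x) mod 3" "cmp (succ x) = cmp x"
proof -
  have "succ x \<in> V \<and> q (succ x) = p x"
    unfolding succ_def by (rule someI_ex) (use succ_ex[OF assms] in auto)
  then show "succ x \<in> V" "q (succ x) = p x" by auto
  then show "blk (succ x) = Suc (blk x) mod 3" "cmp (succ x) = cmp x"
    using link[OF assms] by auto
qed

lemma pred:
  assumes "x \<in> V"
  shows "pred x \<in> V" "p (pred x) = q x" "blk (pred x) = Suc (Suc (blk x)) mod 3" "cmp (pred x) = cmp x"
proof -
  have "pred x \<in> V \<and> p (pred x) = q x"
    unfolding pred_def by (rule someI_ex) (use pred_ex[OF assms] in auto)
  then show *: "pred x \<in> V" "p (pred x) = q x" by auto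
  note l = link[OF *(1) assms *(2)[symmetric]]
  from l show "cmp (pred x) = cmp x" by simp
  have "blk (pred x) = 0 \<or> blk (pred x) = 1 \<or> blk (pred x) = 2" using blk_less[OF *(1)] by linarith
  with l show "blk (pred x) = Suc (Suc (blk x)) mod 3" by (elim disjE) simp_all
qed

text \<open>
  The adjacency kernel of the joined graph. Its three summands are mutually exclusive, as the second
  vertex lies in the same, the next or the previous block, respectively.
\<close>

definition joined_ker :: "'a \<Rightarrow> 'a \<Rightarrow> real" where
  "joined_ker x y = of_bool (adj x y) + of_bool (q y = p x) + of_bool (q x = p y)"

lemma row_sum:
  assumes "y \<in> V"
  shows "(\<Sum>z\<in>V. of_bool (P z) * joined_ker z y) = tally (\<lambda>z. adj y z \<and> P z)
    + tally (\<lambda>z. p z = p (pred y) \<and> P z) + tally (\<lambda>z. q z = q (succ y) \<and> P z)"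
proof -
  have "of_bool (P z) * joined_ker z y = of_bool (adj y z \<and> P z)
      + of_bool (p z = p (pred y) \<and> P z) + of_bool (q z = q (succ y) \<and> P z)" if "z \<in> V" for z
    using adj_sym[OF that assms] adj_sym[OF assms that]
    by (auto simp: joined_ker_def pred[OF assms] succ[OF assms])
  then show ?thesis by (simp add: tally_def sum.distrib)
qed

lemma row_adj:
  assumes "a \<in> V" "y \<in> V"
  shows "(\<Sum>z\<in>V. of_bool (adj a z) * joined_ker z y) =
    of_bool (blk y = blk a) * (2 + 4 * of_bool (y = a))
    + 2 * of_bool (blk a = Suc (Suc (blk y)) mod 3 \<and> p a \<noteq> q y)
    + 2 * of_bool (blk a = Suc (blk y) mod 3 \<and> q a \<noteq> p y)"
proof -
  have "tally (\<lambda>z. p z = p (pred y) \<and> adj a z) = tally (\<lambda>z. adj a z \<and> p z = p (pred y))"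
    "tally (\<lambda>z. q z = q (succ y) \<and> adj a z) = tally (\<lambda>z. adj a z \<and> q z = q (succ y))"
    by (simp_all only: conj_commute)
  then show ?thesis
    unfolding row_sum[OF assms(2)]
    by (simp only: tally_adj_adj[OF assms(2,1)] tally_adj_p[OF assms(1) pred(1)[OF assms(2)]]
        tally_adj_q[OF assms(1) succ(1)[OF assms(2)]]) (simp only: pred[OF assms(2)] succ[OF assms(2)])
qed

lemma row_p:
  assumes "a \<in> V" "y \<in> V"
  shows "(\<Sum>z\<in>V. of_bool (p z = p a) * joined_ker z y) =
    2 * of_bool (blk y = blk a \<and> p y \<noteq> p a) + 4 * of_bool (q y = p a)
    + 2 * of_bool (blk a = Suc (blk y) mod 3 \<and> cmp a = cmp y)"
  unfolding row_sum[OF assms(2)]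
    tally_adj_p[OF assms(2,1)] tally_pp[OF pred(1)[OF assms(2)]]
    tally_qp[OF assms(1) succ(1)[OF assms(2)]]
  by (simp only: pred[OF assms(2)] succ[OF assms(2)])

lemma row_q:
  assumes "a \<in> V" "y \<in> V"
  shows "(\<Sum>z\<in>V. of_bool (q z = q a) * joined_ker z y) =
    2 * of_bool (blk y = blk a \<and> q y \<noteq> q a) + 4 * of_bool (p y = q a)
    + 2 * of_bool (blk a = Suc (Suc (blk y)) mod 3 \<and> cmp a = cmp y)"
  unfolding row_sum[OF assms(2)]
    tally_adj_q[OF assms(2,1)] tally_qq[OF succ(1)[OF assms(2)]]
    tally_pq[OF pred(1)[OF assms(2)] assms(1)]
  by (simp only: pred[OF assms(2)] succ[OF assms(2)] eq_commute[of _ "blk a"] eq_commute[of _ "cmp a"])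

lemma row_blk:
  assumes "y \<in> V"
  shows "(\<Sum>z\<in>V. of_bool (blk z = i) * joined_ker z y) =
    6 * of_bool (blk y = i) + 4 * of_bool (Suc (Suc (blk y)) mod 3 = i)
    + 4 * of_bool (Suc (blk y) mod 3 = i)"
  unfolding row_sum[OF assms]
  by (simp only: tally_adj_blk[OF assms] tally_p_blk[OF pred(1)[OF assms]]
      tally_q_blk[OF succ(1)[OF assms]] pred(3,4)[OF assms] succ(3,4)[OF assms])

lemma row_cell:
  assumes "a \<in> V" "y \<in> V"
  shows "(\<Sum>z\<in>V. of_bool (blk z = blk a \<and> cmp z = cmp a) * joined_ker z y) =
    of_bool (blk y = blk a) * (4 - 2 * of_bool (cmp y = cmp a))
    + 4 * of_bool (Suc (Suc (blk y)) mod 3 = blk a \<and> cmp y = cmp a)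
    + 4 * of_bool (Suc (blk y) mod 3 = blk a \<and> cmp y = cmp a)"
  unfolding row_sum[OF assms(2)]
  by (simp only: tally_adj_cell[OF assms(2,1)] tally_p_blk[OF pred(1)[OF assms(2)]]
      tally_q_blk[OF succ(1)[OF assms(2)]] pred(3,4)[OF assms(2)] succ(3,4)[OF assms(2)])

text \<open>
  The coefficients belong to the kernels \<open>I\<close>, \<open>D\<close>, \<open>B\<close>, \<open>J\<close>, \<open>K\<close>, \<open>S\<close>, \<open>F\<close>, \<open>W\<close>, in this order.
\<close>

definition comb_ker :: "real \<Rightarrow> real \<Rightarrow> real \<Rightarrow> real \<Rightarrow> real \<Rightarrow> real \<Rightarrow> real \<Rightarrow> real \<Rightarrow> 'a \<Rightarrow> 'a \<Rightarrow> real" where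
  "comb_ker a b c d e f g h x y =
     a * of_bool (x = y) + b * of_bool (adj x y) + c * (of_bool (q y = p x) + of_bool (q x = p y))
     + d * of_bool (blk y = blk x) + e * of_bool (blk y \<noteq> blk x)
     + f * (of_bool (p y = p x) + of_bool (q y = q x))
     + g * of_bool (blk y = blk x \<and> cmp y = cmp x) + h * of_bool (blk y \<noteq> blk x \<and> cmp y = cmp x)"

lemma blk_cases:
  assumes "x \<in> V" shows "blk x = 0 \<or> blk x = 1 \<or> blk x = 2"
  using blk_less[OF assms] by linarith

lemma ker_rows:
  assumes x: "x \<in> V" and z: "z \<in> V"
  shows "comb_ker a b c d e f g h x z =
     a * of_bool (x = z) + b * of_bool (adj x z)
     + c * (of_bool (q z = q (succ x)) + of_bool (p z = p (pred x)))
     + d * of_bool (blk z = blk x) + e * (of_bool (blk z = blk (succ x)) + of_bool (blk z = blk (pred x)))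
     + f * (of_bool (p z = p x) + of_bool (q z = q x))
     + g * of_bool (blk z = blk x \<and> cmp z = cmp x)
     + h * (of_bool (blk z = blk (succ x) \<and> cmp z = cmp (succ x))
        + of_bool (blk z = blk (pred x) \<and> cmp z = cmp (pred x)))"
proof -
  have off: "(of_bool (blk z \<noteq> blk x) :: real) = of_bool (blk z = blk (succ x)) + of_bool (blk z = blk (pred x))"
    "(of_bool (blk z \<noteq> blk x \<and> cmp z = cmp x) :: real) =
      of_bool (blk z = blk (succ x) \<and> cmp z = cmp x) + of_bool (blk z = blk (pred x) \<and> cmp z = cmp x)"
    using blk_cases[OF x] blk_cases[OF z] by (auto simp: succ(3)[OF x] pred(3)[OF x])
  show ?thesis
    unfolding comb_ker_def off eq_commute[of "q x" "p z"] succ(2,4)[OF x] pred(2,4)[OF x] by (rule refl)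
qed

text \<open>
  The multiplication table. Each row sum is known for indicators of classes, blocks and cells; what
  remains is to compare both sides for the nine possible pairs of blocks.
\<close>

lemma ker_mult_joined:
  assumes x: "x \<in> V" and y: "y \<in> V"
  shows "(\<Sum>z\<in>V. comb_ker a b c d e f g h x z * joined_ker z y) =
    comb_ker (4 * b) a (a - 2 * b - 2 * c + 4 * f) (2 * b + 6 * d + 8 * e + 4 * f + 4 * g)
      (2 * b + 2 * c + 4 * d + 10 * e + 4 * h) (4 * c - 2 * f) (8 * h - 2 * g)
      (2 * c + 2 * f + 4 * g + 2 * h) x y" (is "?L = ?R")
proof -
  have one: "(\<Sum>z\<in>V. of_bool (x = z) * joined_ker z y) = joined_ker x y"
    using fin x by (subst sum.remove[of _ x]) (auto intro!: sum.neutral)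
  have "?L = a * (\<Sum>z\<in>V. of_bool (x = z) * joined_ker z y)
    + b * (\<Sum>z\<in>V. of_bool (adj x z) * joined_ker z y)
    + c * ((\<Sum>z\<in>V. of_bool (q z = q (succ x)) * joined_ker z y)
         + (\<Sum>z\<in>V. of_bool (p z = p (pred x)) * joined_ker z y))
    + d * (\<Sum>z\<in>V. of_bool (blk z = blk x) * joined_ker z y)
    + e * ((\<Sum>z\<in>V. of_bool (blk z = blk (succ x)) * joined_ker z y)
         + (\<Sum>z\<in>V. of_bool (blk z = blk (pred x)) * joined_ker z y))
    + f * ((\<Sum>z\<in>V. of_bool (p z = p x) * joined_ker z y)
         + (\<Sum>z\<in>V. of_bool (q z = q x) * joined_ker z y))
    + g * (\<Sum>z\<in>V. of_bool (blk z = blk x \<and> cmp z = cmp x) * joined_ker z y)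
    + h * ((\<Sum>z\<in>V. of_bool (blk z = blk (succ x) \<and> cmp z = cmp (succ x)) * joined_ker z y)
         + (\<Sum>z\<in>V. of_bool (blk z = blk (pred x) \<and> cmp z = cmp (pred x)) * joined_ker z y))"
    unfolding sum_distrib_left sum.distrib[symmetric]
    by (intro sum.cong refl) (simp only: ker_rows[OF x] distrib_right distrib_left mult.assoc)
  also have "\<dots> = ?R"
  proof -
    have eqs: "blk x \<noteq> blk y \<Longrightarrow> x \<noteq> y \<and> p x \<noteq> p y \<and> q x \<noteq> q y \<and> \<not> adj x y"
      "blk y \<noteq> Suc (blk x) mod 3 \<Longrightarrow> q y \<noteq> p x" "blk x \<noteq> Suc (blk y) mod 3 \<Longrightarrow> q x \<noteq> p y"
      using p_refines[OF x y] q_refines[OF x y] link[OF x y] link[OF y x] adj_blk[OF x y] by auto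
    \<comment> \<open>one direction for each equation, so that equal indicators become syntactically equal\<close>
    have orient: "y = x \<longleftrightarrow> x = y" "p y = p x \<longleftrightarrow> p x = p y" "q y = q x \<longleftrightarrow> q x = q y"
      "p x = q y \<longleftrightarrow> q y = p x" "p y = q x \<longleftrightarrow> q x = p y" "cmp y = cmp x \<longleftrightarrow> cmp x = cmp y" by auto
    have D: "(\<Sum>z\<in>V. of_bool (adj x z) * joined_ker z y)
        = 4 * of_bool (x = y) + 2 * of_bool (blk y = blk x) - 2 * (of_bool (q y = p x) + of_bool (q x = p y)) + 2 * of_bool (blk y \<noteq> blk x)"
      unfolding row_adj[OF x y] unfolding succ[OF x] pred[OF x]
      using blk_cases[OF x] blk_cases[OF y]
      by (elim disjE) (use eqs in \<open>simp_all add: orient\<close>)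
    have B: "(\<Sum>z\<in>V. of_bool (q z = q (succ x)) * joined_ker z y) + (\<Sum>z\<in>V. of_bool (p z = p (pred x)) * joined_ker z y)
        = 2 * of_bool (blk y \<noteq> blk x) - 2 * (of_bool (q y = p x) + of_bool (q x = p y)) + 4 * (of_bool (p y = p x) + of_bool (q y = q x)) + 2 * of_bool (blk y \<noteq> blk x \<and> cmp y = cmp x)"
      unfolding row_q[OF succ(1)[OF x] y] row_p[OF pred(1)[OF x] y] unfolding succ[OF x] pred[OF x]
      using blk_cases[OF x] blk_cases[OF y]
      by (elim disjE) (use eqs in \<open>simp_all add: orient\<close>)
    have J: "(\<Sum>z\<in>V. of_bool (blk z = blk x) * joined_ker z y)
        = 6 * of_bool (blk y = blk x) + 4 * of_bool (blk y \<noteq> blk x)"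
      unfolding row_blk[OF y] unfolding succ[OF x] pred[OF x]
      using blk_cases[OF x] blk_cases[OF y]
      by (elim disjE) (use eqs in \<open>simp_all add: orient\<close>)
    have K: "(\<Sum>z\<in>V. of_bool (blk z = blk (succ x)) * joined_ker z y) + (\<Sum>z\<in>V. of_bool (blk z = blk (pred x)) * joined_ker z y)
        = 8 * of_bool (blk y = blk x) + 10 * of_bool (blk y \<noteq> blk x)"
      unfolding row_blk[OF y] unfolding succ[OF x] pred[OF x]
      using blk_cases[OF x] blk_cases[OF y]
      by (elim disjE) (use eqs in \<open>simp_all add: orient\<close>)
    have S: "(\<Sum>z\<in>V. of_bool (p z = p x) * joined_ker z y) + (\<Sum>z\<in>V. of_bool (q z = q x) * joined_ker z y)
        = 4 * (of_bool (q y = p x) + of_bool (q x = p y)) - 2 * (of_bool (p y = p x) + of_bool (q y = q x)) + 4 * of_bool (blk y = blk x) + 2 * of_bool (blk y \<noteq> blk x \<and> cmp y = cmp x)"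
      unfolding row_p[OF x y] row_q[OF x y] unfolding succ[OF x] pred[OF x]
      using blk_cases[OF x] blk_cases[OF y]
      by (elim disjE) (use eqs in \<open>simp_all add: orient\<close>)
    have F: "(\<Sum>z\<in>V. of_bool (blk z = blk x \<and> cmp z = cmp x) * joined_ker z y)
        = 4 * of_bool (blk y = blk x) - 2 * of_bool (blk y = blk x \<and> cmp y = cmp x) + 4 * of_bool (blk y \<noteq> blk x \<and> cmp y = cmp x)"
      unfolding row_cell[OF x y] unfolding succ[OF x] pred[OF x]
      using blk_cases[OF x] blk_cases[OF y]
      by (elim disjE) (use eqs in \<open>simp_all add: orient\<close>)
    have W: "(\<Sum>z\<in>V. of_bool (blk z = blk (succ x) \<and> cmp z = cmp (succ x)) * joined_ker z y) + (\<Sum>z\<in>V. of_bool (blk z = blk (pred x) \<and> cmp z = cmp (pred x)) * joined_ker z y)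
        = 4 * of_bool (blk y \<noteq> blk x) + 8 * of_bool (blk y = blk x \<and> cmp y = cmp x) + 2 * of_bool (blk y \<noteq> blk x \<and> cmp y = cmp x)"
      unfolding row_cell[OF succ(1)[OF x] y] row_cell[OF pred(1)[OF x] y] unfolding succ[OF x] pred[OF x]
      using blk_cases[OF x] blk_cases[OF y]
      by (elim disjE) (use eqs in \<open>simp_all add: orient\<close>)
    show ?thesis
      unfolding one D B J K S F W unfolding comb_ker_def joined_ker_def by (simp only: algebra_simps)
  qed
  finally show ?thesis .
qed

end

section \<open>From kernels to matrices\<close>

definition kernel_mat :: "'a list \<Rightarrow> ('a \<Rightarrow> 'a \<Rightarrow> 'b) \<Rightarrow> 'b mat" where
  "kernel_mat vs k = mat (length vs) (length vs) (\<lambda>(i, j). k (vs ! i) (vs ! j))"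

lemma kernel_mat_carrier [simp]: "kernel_mat vs k \<in> carrier_mat (length vs) (length vs)"
  by (simp add: kernel_mat_def)

lemma kernel_mat_cong:
  assumes "\<And>x y. x \<in> set vs \<Longrightarrow> y \<in> set vs \<Longrightarrow> k x y = k' x y"
  shows "kernel_mat vs k = kernel_mat vs k'"
  using assms by (intro eq_matI) (auto simp: kernel_mat_def)

lemma sum_set_distinct_nth: "distinct vs \<Longrightarrow> (\<Sum>x\<in>set vs. f x) = (\<Sum>i<length vs. f (vs ! i))"
  by (metis bij_betw_nth sum.reindex_bij_betw)

lemma kernel_mat_mult:
  fixes k k' :: "'a \<Rightarrow> 'a \<Rightarrow> 'b::semiring_0"
  assumes "distinct vs"
  shows "kernel_mat vs k * kernel_mat vs k' = kernel_mat vs (\<lambda>x y. \<Sum>z\<in>set vs. k x z * k' z y)"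
  by (intro eq_matI)
    (auto simp: kernel_mat_def scalar_prod_def sum_set_distinct_nth[OF assms] atLeast0LessThan)

lemma trace_kernel_mat: "distinct vs \<Longrightarrow> mat_trace (kernel_mat vs k) = (\<Sum>x\<in>set vs. k x x)"
  by (simp add: mat_trace_def kernel_mat_def sum_set_distinct_nth)

section \<open>Determining the multiplicities\<close>

text \<open>
  The five power sums are linear equations in the five multiplicities, with an invertible
  Vandermonde matrix.
\<close>

lemma mset_from_power_sums:
  fixes rs :: "real list"
  assumes sub: "set rs \<subseteq> {14, 6, 2, -2, -6}"
    and sums: "(\<Sum>r\<leftarrow>rs. r ^ 0) = 48" "(\<Sum>r\<leftarrow>rs. r ^ 1) = 0" "(\<Sum>r\<leftarrow>rs. r ^ 2) = 672"
      "(\<Sum>r\<leftarrow>rs. r ^ 3) = 1344" "(\<Sum>r\<leftarrow>rs. r ^ 4) = 50688"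
  shows "mset rs = replicate_mset 1 14 + replicate_mset 1 6 + replicate_mset 26 2 +
    replicate_mset 12 (- 2) + replicate_mset 8 (- 6)"
proof -
  let ?c = "\<lambda>r. real (count (mset rs) r)"
  have ps: "(\<Sum>r\<leftarrow>rs. r ^ k) = ?c 14 * 14 ^ k + ?c 6 * 6 ^ k + ?c 2 * 2 ^ k
      + ?c (- 2) * (- 2) ^ k + ?c (- 6) * (- 6) ^ k" for k
    using sub
  proof (induction rs)
    case (Cons r rs)
    then have "(\<Sum>r\<leftarrow>rs. r ^ k) = real (count (mset rs) 14) * 14 ^ k + real (count (mset rs) 6) * 6 ^ k
      + real (count (mset rs) 2) * 2 ^ k + real (count (mset rs) (- 2)) * (- 2) ^ k
      + real (count (mset rs) (- 6)) * (- 6) ^ k" and "r \<in> {14, 6, 2, -2, -6}" by auto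
    then show ?case by (auto simp: algebra_simps)
  qed simp
  from sums have "?c 14 = 1 \<and> ?c 6 = 1 \<and> ?c 2 = 26 \<and> ?c (- 2) = 12 \<and> ?c (- 6) = 8"
    unfolding ps by simp
  then have c: "count (mset rs) 14 = 1" "count (mset rs) 6 = 1" "count (mset rs) 2 = 26"
    "count (mset rs) (- 2) = 12" "count (mset rs) (- 6) = 8" by linarith+
  show ?thesis
  proof (rule multiset_eqI)
    fix r
    show "count (mset rs) r = count (replicate_mset 1 14 + replicate_mset 1 6 + replicate_mset 26 2 +
      replicate_mset 12 (- 2) + replicate_mset 8 (- 6)) r"
    proof (cases "r \<in> {14, 6, 2, -2, -6}")
      case True
      then show ?thesis using c by (elim insertE) simp_all
    next
      case False
      then have "r \<notin> set rs" using sub by blast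
      then have "count (mset rs) r = 0" by (simp add: count_eq_zero_iff)
      then show ?thesis using False by simp
    qed
  qed
qed

context linked_triple
begin

text \<open>
  Iterates of the coefficient map of \<open>ker_mult_joined\<close>, starting at the identity.
\<close>

lemma joined_ker_powers:
  assumes vs: "distinct vs" "set vs = V"
  defines "A \<equiv> kernel_mat vs joined_ker"
  shows "A ^\<^sub>m 0 = kernel_mat vs (comb_ker 1 0 0 0 0 0 0 0)"
    "A ^\<^sub>m 1 = kernel_mat vs (comb_ker 0 1 1 0 0 0 0 0)"
    "A ^\<^sub>m 2 = kernel_mat vs (comb_ker 4 0 (-4) 2 4 4 0 2)"
    "A ^\<^sub>m 3 = kernel_mat vs (comb_ker 0 4 28 60 48 (-24) 16 4)"
    "A ^\<^sub>m 4 = kernel_mat vs (comb_ker 16 0 (-160) 720 800 160 0 80)"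
    "A ^\<^sub>m 5 = kernel_mat vs (comb_ker 0 16 976 11360 10880 (-960) 640 160)"
proof -
  have step: "kernel_mat vs (comb_ker a b c d e f g h) * A =
    kernel_mat vs (comb_ker (4 * b) a (a - 2 * b - 2 * c + 4 * f) (2 * b + 6 * d + 8 * e + 4 * f + 4 * g)
      (2 * b + 2 * c + 4 * d + 10 * e + 4 * h) (4 * c - 2 * f) (8 * h - 2 * g)
      (2 * c + 2 * f + 4 * g + 2 * h))" for a b c d e f g h
    unfolding A_def kernel_mat_mult[OF vs(1)] vs(2)
    by (rule kernel_mat_cong) (simp only: vs(2) ker_mult_joined)
  show p0: "A ^\<^sub>m 0 = kernel_mat vs (comb_ker 1 0 0 0 0 0 0 0)"
    by (rule eq_matI) (auto simp: A_def kernel_mat_def comb_ker_def nth_eq_iff_index_eq[OF vs(1)])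
  have pow: "A ^\<^sub>m 1 = A ^\<^sub>m 0 * A" "A ^\<^sub>m 2 = A ^\<^sub>m 1 * A" "A ^\<^sub>m 3 = A ^\<^sub>m 2 * A"
    "A ^\<^sub>m 4 = A ^\<^sub>m 3 * A" "A ^\<^sub>m 5 = A ^\<^sub>m 4 * A"
    by (simp_all add: eval_nat_numeral)
  show p1: "A ^\<^sub>m 1 = kernel_mat vs (comb_ker 0 1 1 0 0 0 0 0)"
    unfolding pow(1) p0 step by simp
  show p2: "A ^\<^sub>m 2 = kernel_mat vs (comb_ker 4 0 (-4) 2 4 4 0 2)"
    unfolding pow(2) p1 step by simp
  show p3: "A ^\<^sub>m 3 = kernel_mat vs (comb_ker 0 4 28 60 48 (-24) 16 4)"
    unfolding pow(3) p2 step by simp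
  show p4: "A ^\<^sub>m 4 = kernel_mat vs (comb_ker 16 0 (-160) 720 800 160 0 80)"
    unfolding pow(4) p3 step by simp
  show "A ^\<^sub>m 5 = kernel_mat vs (comb_ker 0 16 976 11360 10880 (-960) 640 160)"
    unfolding pow(5) p4 step by simp
qed

lemma card_V: "card V = 48"
proof -
  have "V = (\<Union>i\<in>{0, 1, 2}. {z \<in> V. blk z = i})" using blk_cases by blast
  moreover have "card (\<Union>i\<in>{0, 1, 2}. {z \<in> V. blk z = i}) = (\<Sum>i\<in>{0, 1, 2::nat}. card {z \<in> V. blk z = i})"
    by (rule card_UN_disjoint) (auto simp: fin)
  ultimately show ?thesis by (simp add: card_blk)
qed

text \<open>
  On the diagonal \<open>I\<close>, \<open>J\<close> and \<open>F\<close> are 1, \<open>S\<close> is 2, and the other kernels vanish.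
\<close>

lemma trace_ker:
  assumes "distinct vs" "set vs = V"
  shows "mat_trace (kernel_mat vs (comb_ker a b c d e f g h)) = 48 * (a + d + 2 * f + g)"
proof -
  have "comb_ker a b c d e f g h x x = a + d + 2 * f + g" if "x \<in> V" for x
  proof -
    have "\<not> adj x x" using p_coclique that by blast
    moreover have "q x \<noteq> p x"
      using link[OF that that] blk_cases[OF that] by auto
    ultimately show ?thesis by (simp add: comb_ker_def)
  qed
  then show ?thesis by (simp add: trace_kernel_mat[OF assms(1)] assms(2) card_V)
qed

lemma spectrum_joined_ker:
  assumes vs: "distinct vs" "set vs = V"
  shows "eigenvalue_mset (kernel_mat vs joined_ker) =
    replicate_mset 1 14 + replicate_mset 1 6 + replicate_mset 26 2 +
    replicate_mset 12 (- 2) + replicate_mset 8 (- 6)"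
proof -
  define A where "A = kernel_mat vs joined_ker"
  note pow = joined_ker_powers[OF vs, folded A_def]
  \<comment> \<open>the coefficients of \<open>(X-14)(X-6)(X-2)(X+2)(X+6)\<close>, lowest degree first\<close>
  define c :: "nat \<Rightarrow> real" where "c k = [-2016, 144, 560, -40, -14, 1] ! k" for k
  have c: "(\<Sum>k<6. f (c k) k) = f (-2016) 0 + f 144 1 + f 560 2 + f (-40) 3 + f (-14) 4 + f 1 5"
    for f :: "real \<Rightarrow> nat \<Rightarrow> 'z::comm_monoid_add"
    by (simp add: c_def eval_nat_numeral)
  have ann: "(\<Sum>k<6. c k * (A ^\<^sub>m k) $$ (i, j)) = 0" if "i < length vs" "j < length vs" for i j
    unfolding c[of "\<lambda>c k. c * (A ^\<^sub>m k) $$ (i, j)"] pow kernel_mat_def comb_ker_def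
    using that by (simp add: algebra_simps)
  have split: "z \<in> complex_of_real ` {14, 6, 2, -2, -6}"
    if "(\<Sum>k<6. complex_of_real (c k) * z ^ k) = 0" for z
  proof -
    have "(z - 14) * (z - 6) * (z - 2) * (z + 2) * (z + 6) = 0"
      using that unfolding c[of "\<lambda>c k. complex_of_real c * z ^ k"]
      by (simp add: algebra_simps eval_nat_numeral)
    then show ?thesis by (auto simp: eq_neg_iff_add_eq_0)
  qed
  obtain rs where rs: "set rs \<subseteq> {14, 6, 2, -2, -6}" "eigenvalue_mset A = mset rs"
    "\<And>k. mat_trace (A ^\<^sub>m k) = (\<Sum>r\<leftarrow>rs. r ^ k)"
    using real_spectrum_of_annihilated_mat[of A "length vs" c 6 "{14, 6, 2, -2, -6}", OF _ ann split]
    by (auto simp: A_def)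
  have "mset rs = replicate_mset 1 14 + replicate_mset 1 6 + replicate_mset 26 2 +
    replicate_mset 12 (- 2) + replicate_mset 8 (- 6)"
    by (rule mset_from_power_sums[OF rs(1)]) (simp_all only: rs(3)[symmetric] pow trace_ker[OF vs], simp_all)
  then show ?thesis using rs(2) by (simp add: A_def)
qed

end

section \<open>The rook graph\<close>

text \<open>
  For digraphs without parallel arcs the arc component of an isomorphism is determined by the vertex
  component, which leaves a relabelling of vertices.
\<close>

lemma digraph_iso_with_projE:
  assumes "digraph_iso (with_proj G) (with_proj H)"
  obtains g where "inj_on g (pverts G)" "pverts H = g ` pverts G" "parcs G \<subseteq> pverts G \<times> pverts G"
    "\<And>u v. u \<in> pverts G \<Longrightarrow> v \<in> pverts G \<Longrightarrow> (g u, g v) \<in> parcs H \<longleftrightarrow> (u, v) \<in> parcs G"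
proof -
  obtain f where f: "pre_digraph.digraph_isomorphism (with_proj G) f"
    and H: "with_proj H = app_iso f (with_proj G)"
    using assms by (auto simp: digraph_iso_def)
  let ?g = "iso_verts f"
  have "wf_digraph (with_proj G)" and inj: "inj_on ?g (pverts G)"
    and ends: "\<And>a. a \<in> parcs G \<Longrightarrow> ?g (fst a) = iso_tail f (iso_arcs f a)"
      "\<And>a. a \<in> parcs G \<Longrightarrow> ?g (snd a) = iso_head f (iso_arcs f a)"
    using f by (auto simp: pre_digraph.digraph_isomorphism_def)
  then have sub: "parcs G \<subseteq> pverts G \<times> pverts G"
    by (auto dest: wf_digraph.tail_in_verts wf_digraph.head_in_verts)
  have verts: "pverts H = ?g ` pverts G" and arcs: "parcs H = iso_arcs f ` parcs G"
    and "fst = iso_tail f" "snd = iso_head f"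
    using arg_cong[OF H, of verts] arg_cong[OF H, of arcs] arg_cong[OF H, of tail]
      arg_cong[OF H, of head] by simp_all
  with ends have "iso_arcs f a = (?g (fst a), ?g (snd a))" if "a \<in> parcs G" for a
    using that by (metis prod.collapse)
  then have arcs': "parcs H = (\<lambda>a. (?g (fst a), ?g (snd a))) ` parcs G"
    unfolding arcs by (rule image_cong[OF refl])
  have "(?g u, ?g v) \<in> parcs H \<longleftrightarrow> (u, v) \<in> parcs G" if "u \<in> pverts G" "v \<in> pverts G" for u v
  proof
    assume "(?g u, ?g v) \<in> parcs H"
    then obtain a where a: "a \<in> parcs G" "?g u = ?g (fst a)" "?g v = ?g (snd a)"
      by (auto simp: arcs')
    with sub have "fst a \<in> pverts G" "snd a \<in> pverts G" by auto
    then have "fst a = u" "snd a = v" using a that inj by (auto dest: inj_onD)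
    then show "(u, v) \<in> parcs G" using a by auto
  next
    assume "(u, v) \<in> parcs G"
    then show "(?g u, ?g v) \<in> parcs H" unfolding arcs' by (rule rev_image_eqI) simp
  qed
  with inj verts sub show ?thesis by (rule that)
qed

text \<open>
  Two squares in different rows and columns are both attacked from exactly the two remaining corners
  of the rectangle that they span.
\<close>

lemma rook_graph_common:
  assumes iso: "digraph_iso (with_proj G) (with_proj rook_graph_4)"
    and x: "x \<in> pverts G" and y: "y \<in> pverts G" and "x \<noteq> y" "(x, y) \<notin> parcs G"
  shows "card (nbrs G x \<inter> nbrs G y) = 2"
proof -
  from iso obtain g where inj: "inj_on g (pverts G)" and verts: "pverts rook_graph_4 = g ` pverts G"
    and sub: "parcs G \<subseteq> pverts G \<times> pverts G"
    and arcs: "\<And>u v. u \<in> pverts G \<Longrightarrow> v \<in> pverts G \<Longrightarrow> (g u, g v) \<in> parcs rook_graph_4 \<longleftrightarrow> (u, v) \<in> parcs G"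
    by (rule digraph_iso_with_projE) blast
  obtain a b where gx: "g x = (a, b)" by fastforce
  obtain c d where gy: "g y = (c, d)" by fastforce
  have bounds: "a < 4" "b < 4" "c < 4" "d < 4"
    using verts x y gx gy
    by (auto simp: rook_graph_4_def cartesian_product_def complete_graph_def dest!: equalityD2)
  have "(a, b) \<noteq> (c, d)" using inj x y \<open>x \<noteq> y\<close> gx gy by (metis inj_onD)
  moreover have "((a, b), (c, d)) \<notin> parcs rook_graph_4" using arcs[OF x y] assms gx gy by simp
  ultimately have ne: "a \<noteq> c" "b \<noteq> d"
    using bounds by (auto simp: rook_graph_4_def cartesian_product_def complete_graph_def)
  have "g ` (nbrs G x \<inter> nbrs G y) = {w \<in> pverts rook_graph_4. (g x, w) \<in> parcs rook_graph_4 \<and> (g y, w) \<in> parcs rook_graph_4}"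
    using arcs x y sub unfolding verts nbrs_def by auto
  also have "\<dots> = {(a, d), (c, b)}"
    using bounds ne by (auto simp: gx gy rook_graph_4_def cartesian_product_def complete_graph_def)
  finally have "card (g ` (nbrs G x \<inter> nbrs G y)) = 2" using ne by simp
  moreover have "inj_on g (nbrs G x \<inter> nbrs G y)"
    by (rule inj_on_subset[OF inj]) (use sub in \<open>auto simp: nbrs_def\<close>)
  ultimately show ?thesis by (simp add: card_image)
qed

section \<open>The construction data form a linked triple\<close>

definition part_of :: "'a set set \<Rightarrow> 'a \<Rightarrow> 'a set" where
  "part_of R x = (THE P. P \<in> R \<and> x \<in> P)"

lemma part_of_eq:
  assumes "partition_on A R" "P \<in> R" "x \<in> P"
  shows "part_of R x = P"
  unfolding part_of_def
  using assms by (intro the_equality) (auto simp: partition_on_def disjoint_def)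

lemma part_of:
  assumes "partition_on A R" "x \<in> A"
  shows "part_of R x \<in> R" "x \<in> part_of R x"
proof -
  obtain P where "P \<in> R" "x \<in> P" using assms by (auto simp: partition_on_def)
  then show "part_of R x \<in> R" "x \<in> part_of R x" using part_of_eq[OF assms(1)] by auto
qed

definition next_index :: "nat \<Rightarrow> nat" where "next_index i = (if i = 3 then 1 else Suc i)"
definition prev_index :: "nat \<Rightarrow> nat" where "prev_index i = (if i = 1 then 3 else i - 1)"

lemma index_simps:
  assumes "i \<in> {1, 2, 3}"
  shows "next_index i \<in> {1, 2, 3}" "prev_index i \<in> {1, 2, 3}"
    "prev_index (next_index i) = i" "next_index (prev_index i) = i"
    "next_index i mod 3 = Suc (i mod 3) mod 3"
  using assms by (auto simp: next_index_def prev_index_def)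

text \<open>
  All that is needed beyond the construction data with \<open>\<lambda> = \<mu> = 2\<close> is that two distinct nonadjacent
  vertices also have 2 common neighbours.
\<close>

locale srg_construction = construction_data 2 2 \<Gamma> \<Omega> \<P> \<P>' \<phi>12 \<phi>23 \<phi>31
  for \<Gamma> :: "nat \<Rightarrow> 'a pair_pre_digraph"
    and \<Omega> \<P> \<P>' :: "nat \<Rightarrow> 'a set set"
    and \<phi>12 \<phi>23 \<phi>31 :: "'a set \<Rightarrow> 'a set" +
  assumes nonadjacent_common: "i \<in> {1, 2, 3} \<Longrightarrow> x \<in> pverts (\<Gamma> i) \<Longrightarrow> y \<in> pverts (\<Gamma> i) \<Longrightarrow>
    x \<noteq> y \<Longrightarrow> (x, y) \<notin> parcs (\<Gamma> i) \<Longrightarrow> card (nbrs (\<Gamma> i) x \<inter> nbrs (\<Gamma> i) y) = 2"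
begin

abbreviation "I \<equiv> {1, 2, 3 :: nat}"

definition vertices where "vertices = pverts (\<Gamma> 1) \<union> pverts (\<Gamma> 2) \<union> pverts (\<Gamma> 3)"

definition index :: "'a \<Rightarrow> nat" where
  "index x = (if x \<in> pverts (\<Gamma> 1) then 1 else if x \<in> pverts (\<Gamma> 2) then 2 else 3)"

definition \<phi> :: "nat \<Rightarrow> 'a set \<Rightarrow> 'a set" where
  "\<phi> i = (if i = 1 then \<phi>12 else if i = 2 then \<phi>23 else \<phi>31)"

abbreviation "cell x \<equiv> part_of (\<Omega> (index x)) x"
abbreviation "class x \<equiv> part_of (\<P> (index x)) x"
abbreviation "class' x \<equiv> part_of (\<P>' (index x)) x"

text \<open>
  The element of the preceding \<open>\<P>\<^sub>i\<close> that is mapped to the class of \<open>x\<close> in \<open>\<P>'\<close>. It consists of the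
  neighbours of \<open>x\<close> in the preceding graph.
\<close>

definition linked_class :: "'a \<Rightarrow> 'a set" where
  "linked_class x = inv_into (\<P> (prev_index (index x))) (\<phi> (prev_index (index x))) (class' x)"

text \<open>
  Moves a cell forward along the cycle of induced maps until it lies in \<open>\<Omega>\<^sub>1\<close>, so that each component
  is named by its cell in \<open>\<Omega>\<^sub>1\<close>.
\<close>

definition transport :: "nat \<Rightarrow> 'a set \<Rightarrow> 'a set" where
  "transport i \<omega> = (if i = 1 then \<omega> else if i = 2
     then induced_map (\<P> 3) (\<phi> 3) (induced_map (\<P> 2) (\<phi> 2) \<omega>) else induced_map (\<P> 3) (\<phi> 3) \<omega>)"

definition component :: "'a \<Rightarrow> 'a set" where "component x = transport (index x) (cell x)"

definition adjacent :: "'a \<Rightarrow> 'a \<Rightarrow> bool" where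
  "adjacent x y \<longleftrightarrow> x \<in> vertices \<and> y \<in> vertices \<and> (x, y) \<in> parcs (\<Gamma> (index x))"

lemma index_eq: "i \<in> I \<Longrightarrow> x \<in> pverts (\<Gamma> i) \<Longrightarrow> index x = i"
  using disjoint_verts[of 1 2] disjoint_verts[of 1 3] disjoint_verts[of 2 3]
  by (auto simp: index_def)

lemma index:
  assumes "x \<in> vertices" shows "index x \<in> I" "x \<in> pverts (\<Gamma> (index x))"
  using assms by (auto simp: vertices_def index_def)

lemma vertsI: "i \<in> I \<Longrightarrow> x \<in> pverts (\<Gamma> i) \<Longrightarrow> x \<in> vertices"
  by (auto simp: vertices_def)

lemma pverts_eq: "i \<in> I \<Longrightarrow> pverts (\<Gamma> i) = {z \<in> vertices. index z = i}"
  using index index_eq vertsI by blast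

lemma pair_graph: "i \<in> I \<Longrightarrow> pair_graph (\<Gamma> i)"
  using edge_regular by (auto simp: edge_regular_def)

lemma parcs_sub: "i \<in> I \<Longrightarrow> (x, y) \<in> parcs (\<Gamma> i) \<Longrightarrow> x \<in> pverts (\<Gamma> i) \<and> y \<in> pverts (\<Gamma> i)"
  using pair_graph[of i] by (simp add: pair_graph_def pair_digraph_def pair_fin_digraph_def
      pair_wf_digraph.in_arcsD1 pair_wf_digraph.in_arcsD2)

lemma parcs_sym:
  assumes "i \<in> I" "(x, y) \<in> parcs (\<Gamma> i)"
  shows "(y, x) \<in> parcs (\<Gamma> i)"
proof -
  have "symmetric (with_proj (\<Gamma> i))"
    using pair_graph[OF assms(1)]
    by (simp add: pair_graph_def pair_pseudo_graph_def pair_sym_digraph_def pair_sym_digraph_axioms_def)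
  then show ?thesis using assms(2) by (auto simp: symmetric_def sym_def)
qed

lemma finite_verts: "finite vertices"
proof -
  have "finite (pverts (\<Gamma> i))" if "i \<in> I" for i
    using pair_graph[OF that]
    by (simp add: pair_graph_def pair_digraph_def pair_fin_digraph_def pair_fin_digraph_axioms_def)
  then show ?thesis by (simp add: vertices_def)
qed

lemma admissible: "i \<in> I \<Longrightarrow> admissible_bijection (\<P> i) (\<Omega> i) (\<P>' (next_index i)) (\<Omega> (next_index i)) (\<phi> i)"
  using admissible_12 admissible_23 admissible_31
  by (auto simp: \<phi>_def next_index_def numeral_2_eq_2 numeral_3_eq_3)

lemma \<phi>_bij: "i \<in> I \<Longrightarrow> bij_betw (\<phi> i) (\<P> i) (\<P>' (next_index i))"
  and induced_in: "i \<in> I \<Longrightarrow> \<omega> \<in> \<Omega> i \<Longrightarrow> induced_map (\<P> i) (\<phi> i) \<omega> \<in> \<Omega> (next_index i)"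
  using admissible by (auto simp: admissible_bijection_def)

text \<open>
  A cell is a union of classes, hence it contains every class that it meets.
\<close>

lemma part_sub_cell:
  assumes i: "i \<in> I" and R: "R \<in> {\<P> i, \<P>' i}" and P: "P \<in> R" "x \<in> P"
  shows "P \<subseteq> part_of (\<Omega> i) x"
proof -
  have "x \<in> pverts (\<Gamma> i)" using \<P>_partition[OF i R] P by (auto simp: partition_on_def)
  from part_of[OF \<Omega>_partition[OF i] this]
  have cell: "part_of (\<Omega> i) x \<in> \<Omega> i" "x \<in> part_of (\<Omega> i) x" .
  from \<Omega>_union[OF i R cell(1)] obtain S where S: "S \<subseteq> R" "part_of (\<Omega> i) x = \<Union> S" by blast
  with cell obtain Q where Q: "Q \<in> S" "x \<in> Q" by auto
  then have "Q = P"
    using part_of_eq[OF \<P>_partition[OF i R]] S P by blast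
  then show ?thesis using S Q by auto
qed

text \<open>
  For \<open>i = 3\<close> and \<open>i = 2\<close> this is how transport is built up; for \<open>i = 1\<close> it says that the composition
  around the cycle is the identity.
\<close>

lemma transport_induced:
  assumes "i \<in> I" "\<omega> \<in> \<Omega> i"
  shows "transport (next_index i) (induced_map (\<P> i) (\<phi> i) \<omega>) = transport i \<omega>"
  using assms composition_id[of \<omega>] by (auto simp: transport_def next_index_def \<phi>_def)

text \<open>
  The composition around the cycle is the identity, so the first induced map is injective and the
  last one surjective. All three \<open>\<Omega>\<^sub>i\<close> have two elements, so all three maps are bijections.
\<close>

lemma inj_transport:
  assumes "i \<in> I" shows "inj_on (transport i) (\<Omega> i)"
proof -
  define f where "f i = induced_map (\<P> i) (\<phi> i)" for i
  have card: "finite (\<Omega> i)" "card (\<Omega> i) = 2" if "i \<in> I" for i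
    using \<Omega>_number[OF that] by (auto intro: card_ge_0_finite)
  have f: "f 1 ` \<Omega> 1 \<subseteq> \<Omega> 2" "f 2 ` \<Omega> 2 \<subseteq> \<Omega> 3" "f 3 ` \<Omega> 3 \<subseteq> \<Omega> 1"
    using induced_in[of 1] induced_in[of 2] induced_in[of 3]
    by (auto simp: f_def next_index_def numeral_2_eq_2 numeral_3_eq_3)
  have id: "f 3 (f 2 (f 1 \<omega>)) = \<omega>" if "\<omega> \<in> \<Omega> 1" for \<omega>
    using composition_id[OF that] by (simp add: f_def \<phi>_def)
  \<comment> \<open>each map in the cycle is a surjection between sets of the same finite size\<close>
  have "inj_on (f 1) (\<Omega> 1)"
    by (rule inj_on_inverseI[of _ "\<lambda>\<omega>. f 3 (f 2 \<omega>)"]) (rule id)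
  then have "card (f 1 ` \<Omega> 1) = card (\<Omega> 2)" using card[of 1] card[of 2] by (simp add: card_image)
  then have "f 1 ` \<Omega> 1 = \<Omega> 2" using f(1) card(1)[of 2] by (intro card_subset_eq) auto
  then have surj: "(\<lambda>\<omega>. f 3 (f 2 \<omega>)) ` \<Omega> 2 = \<Omega> 1"
    using image_cong[OF refl id, of "\<Omega> 1"] by (metis image_ident image_image)
  then have inj2: "inj_on (\<lambda>\<omega>. f 3 (f 2 \<omega>)) (\<Omega> 2)"
    using card[of 1] card[of 2] by (intro eq_card_imp_inj_on) auto
  have "\<Omega> 1 \<subseteq> f 3 ` \<Omega> 3" unfolding surj[symmetric] using f(2) by blast
  then have "f 3 ` \<Omega> 3 = \<Omega> 1" using f(3) by blast
  then have inj3: "inj_on (f 3) (\<Omega> 3)"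
    using card[of 1] card[of 3] by (intro eq_card_imp_inj_on) auto
  consider "i = 1" | "i = 2" | "i = 3" using assms by blast
  then show ?thesis
  proof cases
    case 1
    then show ?thesis by (simp add: transport_def inj_on_def)
  next
    case 2
    then show ?thesis using inj2 by (simp add: transport_def inj_on_def f_def)
  next
    case 3
    then show ?thesis using inj3 by (simp add: transport_def inj_on_def f_def)
  qed
qed

lemma parts:
  assumes "x \<in> vertices"
  shows "cell x \<in> \<Omega> (index x)" "x \<in> cell x" "class x \<in> \<P> (index x)" "x \<in> class x"
    "class' x \<in> \<P>' (index x)" "x \<in> class' x" "class x \<subseteq> cell x" "class' x \<subseteq> cell x"
proof -
  note i = index[OF assms]
  show "cell x \<in> \<Omega> (index x)" "x \<in> cell x"
    by (rule part_of[OF \<Omega>_partition[OF i(1)] i(2)])+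
  show "class x \<in> \<P> (index x)" "x \<in> class x"
    by (rule part_of[OF \<P>_partition[OF i(1)] i(2)]; simp)+
  then show "class x \<subseteq> cell x" by (intro part_sub_cell[OF i(1)]) auto
  show "class' x \<in> \<P>' (index x)" "x \<in> class' x"
    by (rule part_of[OF \<P>_partition[OF i(1)] i(2)]; simp)+
  then show "class' x \<subseteq> cell x" by (intro part_sub_cell[OF i(1)]) auto
qed

lemma cell_eq:
  assumes "i \<in> I" "\<omega> \<in> \<Omega> i" "x \<in> \<omega>" shows "x \<in> vertices \<and> index x = i \<and> cell x = \<omega>"
proof -
  have "x \<in> pverts (\<Gamma> i)" using \<Omega>_partition[OF assms(1)] assms by (auto simp: partition_on_def)
  then show ?thesis
    using assms index_eq vertsI part_of_eq[OF \<Omega>_partition] by simp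
qed

lemma class_eq:
  assumes "i \<in> I" "P \<in> \<P> i" "x \<in> P" shows "x \<in> vertices \<and> index x = i \<and> class x = P"
proof -
  have "x \<in> pverts (\<Gamma> i)" using \<P>_partition[OF assms(1), of "\<P> i"] assms by (auto simp: partition_on_def)
  then show ?thesis
    using assms index_eq vertsI part_of_eq[OF \<P>_partition[of i "\<P> i"]] by simp
qed

lemma class'_eq:
  assumes "i \<in> I" "P \<in> \<P>' i" "x \<in> P" shows "x \<in> vertices \<and> index x = i \<and> class' x = P"
proof -
  have "x \<in> pverts (\<Gamma> i)" using \<P>_partition[OF assms(1), of "\<P>' i"] assms by (auto simp: partition_on_def)
  then show ?thesis
    using assms index_eq vertsI part_of_eq[OF \<P>_partition[of i "\<P>' i"]] by simp
qed

lemma linked_class: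
  assumes "x \<in> vertices"
  shows "linked_class x \<in> \<P> (prev_index (index x))"
    "\<phi> (prev_index (index x)) (linked_class x) = class' x"
proof -
  note i = index_simps[OF index(1)[OF assms]]
  have "class' x \<in> \<phi> (prev_index (index x)) ` \<P> (prev_index (index x))"
    using parts(5)[OF assms] \<phi>_bij[OF i(2)] by (simp add: i(4) bij_betw_def)
  then show "linked_class x \<in> \<P> (prev_index (index x))"
    "\<phi> (prev_index (index x)) (linked_class x) = class' x"
    unfolding linked_class_def by (rule inv_into_into, rule f_inv_into_f)
qed

lemma class_nonempty:
  assumes "i \<in> I" "R \<in> {\<P> i, \<P>' i}" "P \<in> R"
  obtains x where "x \<in> P"
  using \<P>_size[OF assms] by (metis card.empty ex_in_conv mult_is_0 zero_neq_numeral)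

lemma linked_class_eq_iff:
  assumes x: "x \<in> vertices" and y: "y \<in> vertices"
  shows "linked_class y = class x \<longleftrightarrow> y \<in> \<phi> (index x) (class x)"
proof
  assume eq: "linked_class y = class x"
  have "x \<in> linked_class y" using parts(4)[OF x] eq by simp
  then have "index x = prev_index (index y)"
    using class_eq index_simps(2)[OF index(1)[OF y]] linked_class(1)[OF y] by blast
  then show "y \<in> \<phi> (index x) (class x)"
    using linked_class(2)[OF y] parts(6)[OF y] eq by simp
next
  assume yP: "y \<in> \<phi> (index x) (class x)"
  note i = index(1)[OF x]
  have P: "\<phi> (index x) (class x) \<in> \<P>' (next_index (index x))"
    by (rule bij_betwE[OF \<phi>_bij[OF i], rule_format]) (rule parts(3)[OF x])
  from class'_eq[OF index_simps(1)[OF i] P yP]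
  have y': "index y = next_index (index x)" "class' y = \<phi> (index x) (class x)" by blast+
  show "linked_class y = class x"
    unfolding linked_class_def y'(2) unfolding y'(1) index_simps(3)[OF i]
    by (rule inv_into_f_f[OF bij_betw_imp_inj_on[OF \<phi>_bij[OF i]] parts(3)[OF x]])
qed

text \<open>
  Adjacent vertices in consecutive graphs lie in cells that correspond under the induced map, hence in
  the same component.
\<close>

lemma linked_class_link:
  assumes x: "x \<in> vertices" and y: "y \<in> vertices" and eq: "linked_class y = class x"
  shows "index y = next_index (index x)" "component y = component x"
proof -
  note i = index(1)[OF x]
  let ?P = "\<phi> (index x) (class x)" and ?\<omega> = "induced_map (\<P> (index x)) (\<phi> (index x)) (cell x)"
  have yP: "y \<in> ?P" using linked_class_eq_iff[OF x y] eq by simp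
  have "?P \<subseteq> ?\<omega>" using parts(3,7)[OF x] by (auto simp: induced_map_def)
  with yP have "y \<in> ?\<omega>" by blast
  from cell_eq[OF index_simps(1)[OF i] induced_in[OF i parts(1)[OF x]] this]
  have *: "index y = next_index (index x)" "cell y = ?\<omega>" by blast+
  show "index y = next_index (index x)" by (rule *)
  show "component y = component x"
    unfolding component_def *(2) unfolding *(1) by (rule transport_induced[OF i parts(1)[OF x]])
qed

lemma same_cell:
  assumes "x \<in> vertices" "y \<in> vertices" "index x = index y"
  shows "component x = component y \<longleftrightarrow> cell x = cell y"
  using inj_onD[OF inj_transport[OF index(1)[OF assms(2)]], of "cell x" "cell y"] parts(1)[OF assms(1)]
    parts(1)[OF assms(2)] assms(3) by (auto simp: component_def)

lemma component_cong: "index x = index y \<Longrightarrow> cell x = cell y \<Longrightarrow> component x = component y"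
  unfolding component_def by (rule arg_cong2[where f = transport])

lemma cell_set:
  assumes x: "x \<in> vertices"
  shows "{z \<in> vertices. index z = index x \<and> component z = component x} = cell x"
proof -
  have "z \<in> cell x" if "z \<in> vertices" "index z = index x" "component z = component x" for z
    using same_cell[OF that(1) x that(2)] that(3) parts(2)[OF that(1)] by simp
  moreover have "z \<in> vertices \<and> index z = index x \<and> component z = component x" if "z \<in> cell x" for z
    using cell_eq[OF index(1)[OF x] parts(1)[OF x] that] component_cong by blast
  ultimately show ?thesis by blast
qed

lemma class_set:
  assumes x: "x \<in> vertices"
  shows "{z \<in> vertices. class z = class x} = class x"
  using class_eq[OF index(1)[OF x] parts(3)[OF x]] parts(4) by blast

lemma class_index:
  assumes "x \<in> vertices" "y \<in> vertices" "class x = class y"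
  shows "index x = index y"
proof -
  have "x \<in> class y" using parts(4)[OF assms(1)] unfolding assms(3) .
  then show ?thesis using class_eq[OF index(1)[OF assms(2)] parts(3)[OF assms(2)]] by blast
qed

text \<open>
  Preimages under a bijection determine their images, and classes of different graphs are disjoint
  and nonempty, so the label also determines the graph.
\<close>

lemma linked_class_same:
  assumes x: "x \<in> vertices" and y: "y \<in> vertices"
  shows "linked_class x = linked_class y \<longleftrightarrow> class' x = class' y"
proof
  assume eq: "linked_class x = linked_class y"
  note i = index_simps[OF index(1)[OF x]] and j = index_simps[OF index(1)[OF y]]
  obtain u where ux: "u \<in> linked_class x"
    using class_nonempty[OF i(2) _ linked_class(1)[OF x]] by blast
  then have uy: "u \<in> linked_class y" unfolding eq .
  have "prev_index (index x) = prev_index (index y)"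
    using class_eq[OF i(2) linked_class(1)[OF x] ux] class_eq[OF j(2) linked_class(1)[OF y] uy]
    by (elim conjE) (rule trans[OF sym])
  then show "class' x = class' y"
    unfolding linked_class(2)[OF x, symmetric] linked_class(2)[OF y, symmetric] eq by (rule arg_cong)
next
  assume eq: "class' x = class' y"
  have "x \<in> class' y" using parts(6)[OF x] unfolding eq .
  then have "index x = index y" using class'_eq[OF index(1)[OF y] parts(5)[OF y]] by blast
  then show "linked_class x = linked_class y" unfolding linked_class_def eq by (rule arg_cong)
qed

lemma class'_set:
  assumes x: "x \<in> vertices"
  shows "{z \<in> vertices. linked_class z = linked_class x} = class' x"
proof -
  have "{z \<in> vertices. linked_class z = linked_class x} = {z \<in> vertices. class' z = class' x}"
    using linked_class_same[OF _ x] by blast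
  also have "\<dots> = class' x"
    using class'_eq[OF index(1)[OF x] parts(5)[OF x]] parts(6) by blast
  finally show ?thesis .
qed

lemma nbrs_eq: "x \<in> vertices \<Longrightarrow> {z \<in> vertices. adjacent x z} = nbrs (\<Gamma> (index x)) x"
  using parcs_sub[OF index(1)] vertsI[OF index(1)] by (auto simp: adjacent_def nbrs_def)

lemma adjacent_index:
  assumes "adjacent x y" shows "index x = index y"
proof -
  from assms have x: "x \<in> vertices" and arc: "(x, y) \<in> parcs (\<Gamma> (index x))"
    by (auto simp: adjacent_def)
  then have "y \<in> pverts (\<Gamma> (index x))" using parcs_sub[OF index(1)[OF x]] by blast
  then show ?thesis by (rule index_eq[OF index(1)[OF x], symmetric])
qed

lemma adjacent_sym:
  assumes "adjacent x y" shows "adjacent y x"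
proof -
  from assms have x: "x \<in> vertices" "y \<in> vertices" and arc: "(x, y) \<in> parcs (\<Gamma> (index x))"
    by (auto simp: adjacent_def)
  from parcs_sym[OF index(1)[OF x(1)] arc] show ?thesis
    using x unfolding adjacent_def adjacent_index[OF assms] by blast
qed

lemma linked_triple: "linked_triple vertices adjacent (\<lambda>x. index x mod 3) class linked_class component"
proof
  have mod: "index x mod 3 = index y mod 3 \<longleftrightarrow> index x = index y" if "x \<in> vertices" "y \<in> vertices" for x y
    using index(1)[OF that(1)] index(1)[OF that(2)] by auto
  show "finite vertices" by (rule finite_verts)
  show "index x mod 3 < 3" for x by simp
  show "card {z \<in> vertices. index z mod 3 = i} = 16" if "i < 3" for i
  proof -
    define j where "j = (if i = 0 then 3 else i)"
    have j: "j \<in> I" "j mod 3 = i" using that by (auto simp: j_def)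
    have "{z \<in> vertices. index z mod 3 = i} = pverts (\<Gamma> j)"
      unfolding pverts_eq[OF j(1)] using j index(1) by fastforce
    then show ?thesis using edge_regular[OF j(1)] by (simp add: edge_regular_def)
  qed
  fix x assume x: "x \<in> vertices"
  note i = index(1)[OF x]
  have "{z \<in> vertices. index z mod 3 = index x mod 3 \<and> component z = component x} = cell x"
    unfolding cell_set[OF x, symmetric] using mod x by blast
  then show "card {z \<in> vertices. index z mod 3 = index x mod 3 \<and> component z = component x} = 8"
    using \<Omega>_size[OF i parts(1)[OF x]] by simp
  show "card {z \<in> vertices. class z = class x} = 4"
    unfolding class_set[OF x] using \<P>_size[OF i _ parts(3)[OF x]] by simp
  show "card {z \<in> vertices. linked_class z = linked_class x} = 4"
    unfolding class'_set[OF x] using \<P>_size[OF i _ parts(5)[OF x]] by simp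
  show "\<exists>y\<in>vertices. linked_class y = class x"
  proof -
    have P: "\<phi> (index x) (class x) \<in> \<P>' (next_index (index x))"
      by (rule bij_betwE[OF \<phi>_bij[OF i], rule_format]) (rule parts(3)[OF x])
    obtain y where y: "y \<in> \<phi> (index x) (class x)"
      using class_nonempty[OF index_simps(1)[OF i] _ P] by blast
    then have "y \<in> vertices" using class'_eq[OF index_simps(1)[OF i] P] by blast
    then show ?thesis using linked_class_eq_iff[OF x] y by blast
  qed
  show "\<exists>y\<in>vertices. class y = linked_class x"
  proof -
    obtain y where "y \<in> linked_class x"
      using class_nonempty[OF index_simps(2)[OF i] _ linked_class(1)[OF x]] by blast
    then show ?thesis using class_eq[OF index_simps(2)[OF i] linked_class(1)[OF x]] by blast
  qed
  show "card {z \<in> vertices. adjacent x z} = 6"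
    unfolding nbrs_eq[OF x] using edge_regular[OF i] index[OF x] by (simp add: edge_regular_def)
  fix y assume y: "y \<in> vertices"
  show "index x mod 3 = index y mod 3 \<and> component x = component y" if "class x = class y"
  proof -
    have "index x = index y" using class_index[OF x y that] .
    moreover have "x \<in> cell y" using parts(4)[OF x] parts(7)[OF y] that by auto
    then have "cell x = cell y" using cell_eq[OF index(1)[OF y] parts(1)[OF y]] by blast
    ultimately have "component x = component y" by (intro component_cong)
    with \<open>index x = index y\<close> show ?thesis by (intro conjI arg_cong[where f = "\<lambda>i. i mod 3"])
  qed
  show "index x mod 3 = index y mod 3 \<and> component x = component y" if "linked_class x = linked_class y"
  proof -
    have "class' x = class' y" using linked_class_same[OF x y] that by simp
    then have "x \<in> cell y" using parts(6)[OF x] parts(8)[OF y] by auto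
    then have "index x = index y" "cell x = cell y"
      using cell_eq[OF index(1)[OF y] parts(1)[OF y]] by blast+
    then show ?thesis using component_cong by metis
  qed
  show "card {z \<in> vertices. class z = class x \<and> linked_class z = linked_class y} = 2"
    if "index x mod 3 = index y mod 3" "component x = component y"
  proof -
    have ij: "index x = index y" using that mod x y by blast
    then have "cell x = cell y" using same_cell[OF x y] that by simp
    then have "card (class x \<inter> class' y) = 2"
      using intersection_size[OF i, of "cell x" "class x" "class' y"] parts[OF x] parts[OF y] ij by simp
    moreover have "{z \<in> vertices. class z = class x \<and> linked_class z = linked_class y} = class x \<inter> class' y"
      using class_set[OF x] class'_set[OF y] by blast
    ultimately show ?thesis by simp
  qed
  show "index y mod 3 = Suc (index x mod 3) mod 3 \<and> component y = component x"
    if "linked_class y = class x"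
    using linked_class_link[OF x y that] index_simps(5)[OF i] by simp
  show "adjacent y x" if "adjacent x y" using adjacent_sym that .
  show "index x mod 3 = index y mod 3" if "adjacent x y" using adjacent_index that by simp
  show "card {z \<in> vertices. adjacent x z \<and> adjacent z y} = 2"
    if "x \<noteq> y" "index x mod 3 = index y mod 3"
  proof -
    have ij: "index x = index y" using that mod x y by blast
    have "{z \<in> vertices. adjacent x z \<and> adjacent z y} = {z \<in> vertices. adjacent x z} \<inter> {z \<in> vertices. adjacent y z}"
      using adjacent_sym by blast
    also have "\<dots> = nbrs (\<Gamma> (index x)) x \<inter> nbrs (\<Gamma> (index x)) y"
      by (simp add: nbrs_eq x y ij)
    finally have eq: "{z \<in> vertices. adjacent x z \<and> adjacent z y} = nbrs (\<Gamma> (index x)) x \<inter> nbrs (\<Gamma> (index x)) y" .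
    have yi: "y \<in> pverts (\<Gamma> (index x))" using index(2)[OF y] unfolding ij .
    show ?thesis
    proof (cases "(x, y) \<in> parcs (\<Gamma> (index x))")
      case True
      then show ?thesis
        using edge_regular[OF i] index(2)[OF x] yi unfolding edge_regular_def eq by blast
    next
      case False
      then show ?thesis unfolding eq by (rule nonadjacent_common[OF i index(2)[OF x] yi that(1)])
    qed
  qed
  show "\<not> adjacent x y" if "class x = class y"
    using \<P>_independent[OF i _ parts(3)[OF x]] parts(4)[OF x] parts(4)[OF y] that
    by (auto simp: independent_set_def adjacent_def)
  show "\<not> adjacent x y" if "linked_class x = linked_class y"
    using \<P>_independent[OF i _ parts(5)[OF x]] parts(6)[OF x] parts(6)[OF y] that
      linked_class_same[OF x y]
    by (auto simp: independent_set_def adjacent_def)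
qed

lemma cross_arcs_iff:
  assumes x: "x \<in> vertices" and y: "y \<in> vertices" and i: "i \<in> I"
  shows "(x, y) \<in> cross_arcs (\<P> i) (\<phi> i) \<longleftrightarrow> index x = i \<and> linked_class y = class x"
  using class_eq[OF i] parts(3,4)[OF x] unfolding linked_class_eq_iff[OF x y]
  by (auto simp: cross_arcs_def)

lemma joined_arcs_iff:
  assumes x: "x \<in> vertices" and y: "y \<in> vertices"
  shows "(x, y) \<in> parcs (joined_graph \<Gamma> \<P> \<phi>12 \<phi>23 \<phi>31) \<longleftrightarrow>
    adjacent x y \<or> linked_class y = class x \<or> linked_class x = class y"
proof -
  have "(x, y) \<in> parcs (\<Gamma> i) \<longleftrightarrow> index x = i \<and> adjacent x y" if "i \<in> I" for i
    using that x y parcs_sub[OF that, of x y] index_eq[OF that, of x] by (auto simp: adjacent_def)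
  moreover have "(u, v) \<in> cross_arcs (\<P> 1) \<phi>12 \<union> cross_arcs (\<P> 2) \<phi>23 \<union> cross_arcs (\<P> 3) \<phi>31
      \<longleftrightarrow> linked_class v = class u" if "u \<in> vertices" "v \<in> vertices" for u v
    using cross_arcs_iff[OF that, of 1] cross_arcs_iff[OF that, of 2] cross_arcs_iff[OF that, of 3]
      index(1)[OF that(1)] by (auto simp: \<phi>_def)
  note this[OF x y] this[OF y x]
  ultimately show ?thesis
    using index(1)[OF x] by (auto simp: joined_graph_def Let_def)
qed

lemma joined_spectrum:
  assumes vs: "distinct vs" "set vs = pverts (joined_graph \<Gamma> \<P> \<phi>12 \<phi>23 \<phi>31)"
  shows "eigenvalue_mset (adjacency_matrix (joined_graph \<Gamma> \<P> \<phi>12 \<phi>23 \<phi>31) vs) =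
    replicate_mset 1 14 + replicate_mset 1 6 + replicate_mset 26 2 +
    replicate_mset 12 (- 2) + replicate_mset 8 (- 6)"
proof -
  interpret L: linked_triple vertices adjacent "\<lambda>x. index x mod 3" "\<lambda>x. class x" linked_class component
    by (rule linked_triple)
  have V: "set vs = vertices" using vs by (simp add: joined_graph_def Let_def vertices_def)
  have "adjacency_matrix (joined_graph \<Gamma> \<P> \<phi>12 \<phi>23 \<phi>31) vs = kernel_mat vs
      (\<lambda>x y. of_bool ((x, y) \<in> parcs (joined_graph \<Gamma> \<P> \<phi>12 \<phi>23 \<phi>31)))"
    by (simp add: adjacency_matrix_def kernel_mat_def of_bool_def)
  also have "\<dots> = kernel_mat vs L.joined_ker"
  proof (rule kernel_mat_cong)
    fix x y assume "x \<in> set vs" "y \<in> set vs"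
    then have xy: "x \<in> vertices" "y \<in> vertices" using V by auto
    \<comment> \<open>the three kinds of edges lead to different blocks, so they exclude one another\<close>
    have "index x mod 3 \<in> {0, 1, 2}" by auto
    then show "of_bool ((x, y) \<in> parcs (joined_graph \<Gamma> \<P> \<phi>12 \<phi>23 \<phi>31)) = L.joined_ker x y"
      using L.adj_blk[OF xy] L.link[OF xy] L.link[OF xy(2,1)]
      by (auto simp: joined_arcs_iff[OF xy] L.joined_ker_def)
  qed
  finally show ?thesis using L.spectrum_joined_ker[OF vs(1) V] by simp
qed

end

section \<open>The spectrum of the joined graph\<close>

theorem mainTheorem3:
  fixes \<Gamma> :: "nat \<Rightarrow> 'a pair_pre_digraph"
    and \<Omega> \<P> \<P>' :: "nat \<Rightarrow> 'a set set"
    and \<phi>12 \<phi>23 \<phi>31 :: "'a set \<Rightarrow> 'a set"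
    and vs :: "'a list"
  assumes data: "construction_data 2 2 \<Gamma> \<Omega> \<P> \<P>' \<phi>12 \<phi>23 \<phi>31"
    and rook_or_shrikhande:
      "\<And>i. i \<in> {1, 2, 3} \<Longrightarrow>
         digraph_iso (with_proj (\<Gamma> i)) (with_proj rook_graph_4) \<or> is_shrikhande_graph (\<Gamma> i)"
    and enumeration: "distinct vs" "set vs = pverts (joined_graph \<Gamma> \<P> \<phi>12 \<phi>23 \<phi>31)"
  shows "eigenvalue_mset (adjacency_matrix (joined_graph \<Gamma> \<P> \<phi>12 \<phi>23 \<phi>31) vs) =
         replicate_mset 1 14 + replicate_mset 1 6 + replicate_mset 26 2 +
         replicate_mset 12 (- 2) + replicate_mset 8 (- 6)"
proof -
  have common: "card (nbrs (\<Gamma> i) x \<inter> nbrs (\<Gamma> i) y) = 2"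
    if "i \<in> {1, 2, 3}" "x \<in> pverts (\<Gamma> i)" "y \<in> pverts (\<Gamma> i)" "x \<noteq> y" "(x, y) \<notin> parcs (\<Gamma> i)"
    for i x y
    using rook_or_shrikhande[OF that(1)]
  proof
    assume "digraph_iso (with_proj (\<Gamma> i)) (with_proj rook_graph_4)"
    then show ?thesis by (rule rook_graph_common[OF _ that(2-5)])
  next
    assume "is_shrikhande_graph (\<Gamma> i)"
    then show ?thesis
      using that(2-5) by (simp add: is_shrikhande_graph_def strongly_regular_def)
  qed
  have "srg_construction \<Gamma> \<Omega> \<P> \<P>' \<phi>12 \<phi>23 \<phi>31"
    by (intro srg_construction.intro[OF data] srg_construction_axioms.intro common)
  then show ?thesis using enumeration by (rule srg_construction.joined_spectrum)
qed

end
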